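(* Let $n\geqslant 10$ and let $\rho: B_n\to GL_r(\mathbb{C})$ be an irreducible matrix representation of $B_n$ (of any dimension $r$). Then $\mathrm{rank}(\rho(\sigma_i)-I)\neq 3$ for all $i=1,2,\dots,n-1$.
   Context: $B_n$ is the braid group on $n$ strings, presented by the standard generators $\sigma_1,\dots,\sigma_{n-1}$ with relations $\sigma_i\sigma_j=\sigma_j\sigma_i$ for $|i-j|\geqslant 2$ and $\sigma_i\sigma_{i+1}\sigma_i=\sigma_{i+1}\sigma_i\sigma_{i+1}$ for $1\leqslant i\leqslant n-2$. *)

theory Defs
  imports "HOL-Analysis.Analysis" "HOL-Algebra.Group"
begin

section \<open>Groups given by generators and relations\<close>

text \<open>
  A word over a set of generators \<open>S\<close> is a list of letters; the letter \<open>(s, True)\<close> stands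
  for the generator \<open>s\<close> and \<open>(s, False)\<close> for its formal inverse.
\<close>

definition words :: "'s set \<Rightarrow> ('s \<times> bool) list set" where
  "words S = lists (S \<times> UNIV)"

inductive pres_eq ::
  "'s set \<Rightarrow> (('s \<times> bool) list \<times> ('s \<times> bool) list) set \<Rightarrow>
    ('s \<times> bool) list \<Rightarrow> ('s \<times> bool) list \<Rightarrow> bool"
  for S R where
  refl: "u \<in> words S \<Longrightarrow> pres_eq S R u u"
| sym: "pres_eq S R u v \<Longrightarrow> pres_eq S R v u"
| trans: "pres_eq S R u v \<Longrightarrow> pres_eq S R v w \<Longrightarrow> pres_eq S R u w"
| append: "pres_eq S R u u' \<Longrightarrow> pres_eq S R v v' \<Longrightarrow> pres_eq S R (u @ v) (u' @ v')"
| cancel: "s \<in> S \<Longrightarrow> pres_eq S R [(s, b), (s, \<not> b)] []"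
| relation: "(u, v) \<in> R \<Longrightarrow> u \<in> words S \<Longrightarrow> v \<in> words S \<Longrightarrow> pres_eq S R u v"

definition word_class ::
  "'s set \<Rightarrow> (('s \<times> bool) list \<times> ('s \<times> bool) list) set \<Rightarrow>
    ('s \<times> bool) list \<Rightarrow> ('s \<times> bool) list set" where
  "word_class S R u = {v. pres_eq S R u v}"

text \<open>The group \<open>\<langle>S | u = v for (u, v) \<in> R\<rangle>\<close>, multiplication being concatenation of words.\<close>

definition presented_group ::
  "'s set \<Rightarrow> (('s \<times> bool) list \<times> ('s \<times> bool) list) set \<Rightarrow>
    ('s \<times> bool) list set monoid" where
  "presented_group S R =
    \<lparr>carrier = word_class S R ` words S,
     mult = (\<lambda>X Y. \<Union>x\<in>X. \<Union>y\<in>Y. word_class S R (x @ y)),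
     one = word_class S R []\<rparr>"

lemma words_append: "u @ v \<in> words S \<longleftrightarrow> u \<in> words S \<and> v \<in> words S"
  by (auto simp: words_def)

lemma words_Nil: "[] \<in> words S"
  by (simp add: words_def)

lemma pres_eq_words: "pres_eq S R u v \<Longrightarrow> u \<in> words S \<and> v \<in> words S"
  by (induction rule: pres_eq.induct) (auto simp: words_def)

lemma word_class_eq_iff:
  assumes "u \<in> words S"
  shows "word_class S R u = word_class S R v \<longleftrightarrow> pres_eq S R u v"
proof
  assume "word_class S R u = word_class S R v"
  moreover have "u \<in> word_class S R u"
    using assms by (simp add: word_class_def pres_eq.refl)
  ultimately show "pres_eq S R u v"
    by (auto simp: word_class_def intro: pres_eq.sym)
next
  assume "pres_eq S R u v"
  then show "word_class S R u = word_class S R v"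
    by (auto simp: word_class_def intro: pres_eq.sym pres_eq.trans)
qed

lemma carrier_presented_group: "carrier (presented_group S R) = word_class S R ` words S"
  by (simp add: presented_group_def)

lemma one_presented_group: "\<one>\<^bsub>presented_group S R\<^esub> = word_class S R []"
  by (simp add: presented_group_def)

lemma mult_presented_group:
  assumes "u \<in> words S" "v \<in> words S"
  shows "word_class S R u \<otimes>\<^bsub>presented_group S R\<^esub> word_class S R v = word_class S R (u @ v)"
proof -
  have *: "word_class S R (x @ y) = word_class S R (u @ v)"
    if "pres_eq S R u x" "pres_eq S R v y" for x y
    using that by (metis pres_eq.append pres_eq_words word_class_eq_iff)
  have ne: "u \<in> word_class S R u" "v \<in> word_class S R v"
    using assms by (auto simp: word_class_def intro: pres_eq.refl)
  have "(\<Union>x\<in>word_class S R u. \<Union>y\<in>word_class S R v. word_class S R (x @ y)) =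
      (\<Union>x\<in>word_class S R u. \<Union>y\<in>word_class S R v. word_class S R (u @ v))"
    by (intro SUP_cong HOL.refl *) (simp_all add: word_class_def)
  also have "\<dots> = word_class S R (u @ v)"
    using ne by blast
  finally show ?thesis
    by (simp add: presented_group_def)
qed

definition inv_word :: "('s \<times> bool) list \<Rightarrow> ('s \<times> bool) list" where
  "inv_word u = rev (map (\<lambda>(s, b). (s, \<not> b)) u)"

lemma inv_word_words: "u \<in> words S \<Longrightarrow> inv_word u \<in> words S"
  by (auto simp: words_def inv_word_def)

lemma inv_word_cancel: "u \<in> words S \<Longrightarrow> pres_eq S R (inv_word u @ u) []"
proof (induction u)
  case Nil
  then show ?case by (simp add: inv_word_def pres_eq.refl)
next
  case (Cons a u)
  obtain s b where a: "a = (s, b)" by force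
  have s: "s \<in> S" and u: "u \<in> words S"
    using Cons.prems by (auto simp: words_def a)
  have "pres_eq S R [(s, \<not> b), (s, b)] []"
    using pres_eq.cancel[OF s, of R "\<not> b"] by simp
  then have "pres_eq S R (inv_word u @ [(s, \<not> b), (s, b)] @ u) (inv_word u @ [] @ u)"
    by (intro pres_eq.append pres_eq.refl inv_word_words u)
  then show ?case
    using Cons.IH[OF u] by (auto simp: inv_word_def a intro: pres_eq.trans)
qed

lemma group_presented_group: "Group.group (presented_group S R)"
proof (rule groupI)
  fix x assume "x \<in> carrier (presented_group S R)"
  then obtain u where u: "u \<in> words S" "x = word_class S R u"
    by (auto simp: carrier_presented_group)
  have "word_class S R (inv_word u @ u) = word_class S R []"
    using u inv_word_cancel[of u S R] inv_word_words[of u S]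
    by (subst word_class_eq_iff) (auto simp: words_append)
  then show "\<exists>y\<in>carrier (presented_group S R).
      y \<otimes>\<^bsub>presented_group S R\<^esub> x = \<one>\<^bsub>presented_group S R\<^esub>"
    using u inv_word_words[of u S]
    by (auto simp: carrier_presented_group mult_presented_group one_presented_group)
qed (auto simp: carrier_presented_group mult_presented_group one_presented_group
  words_append words_Nil)

section \<open>The braid group\<close>

definition braid_rels :: "nat \<Rightarrow> ((nat \<times> bool) list \<times> (nat \<times> bool) list) set" where
  "braid_rels n =
    {([(i, True), (j, True)], [(j, True), (i, True)]) | i j.
        i \<in> {1..n - 1} \<and> j \<in> {1..n - 1} \<and> \<bar>int i - int j\<bar> \<ge> 2} \<union>
    {([(i, True), (i + 1, True), (i, True)], [(i + 1, True), (i, True), (i + 1, True)]) | i.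
        i \<in> {1..n - 2}}"

definition braid_group :: "nat \<Rightarrow> (nat \<times> bool) list set monoid" where
  "braid_group n = presented_group {1..n - 1} (braid_rels n)"

definition braid_gen :: "nat \<Rightarrow> nat \<Rightarrow> (nat \<times> bool) list set" where
  "braid_gen n i = word_class {1..n - 1} (braid_rels n) [(i, True)]"

lemma group_braid_group: "Group.group (braid_group n)"
  by (simp add: braid_group_def group_presented_group)

lemma braid_gen_closed: "i \<in> {1..n - 1} \<Longrightarrow> braid_gen n i \<in> carrier (braid_group n)"
  by (auto simp: braid_gen_def braid_group_def carrier_presented_group words_def)

lemma braid_gen_commute:
  assumes "i \<in> {1..n - 1}" "j \<in> {1..n - 1}" "\<bar>int i - int j\<bar> \<ge> 2"
  shows "braid_gen n i \<otimes>\<^bsub>braid_group n\<^esub> braid_gen n j =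
         braid_gen n j \<otimes>\<^bsub>braid_group n\<^esub> braid_gen n i"
proof -
  have "pres_eq {1..n - 1} (braid_rels n) [(i, True), (j, True)] [(j, True), (i, True)]"
    using assms by (intro pres_eq.relation) (auto simp: braid_rels_def words_def)
  then show ?thesis
    using assms by (simp add: braid_gen_def braid_group_def mult_presented_group words_def
      word_class_eq_iff)
qed

lemma braid_gen_braid:
  assumes "i \<in> {1..n - 2}"
  shows "braid_gen n i \<otimes>\<^bsub>braid_group n\<^esub> braid_gen n (i + 1) \<otimes>\<^bsub>braid_group n\<^esub> braid_gen n i =
         braid_gen n (i + 1) \<otimes>\<^bsub>braid_group n\<^esub> braid_gen n i \<otimes>\<^bsub>braid_group n\<^esub> braid_gen n (i + 1)"
proof -
  have i: "i \<in> {1..n - 1}" "i + 1 \<in> {1..n - 1}"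
    using assms by auto
  have "pres_eq {1..n - 1} (braid_rels n)
     [(i, True), (i + 1, True), (i, True)] [(i + 1, True), (i, True), (i + 1, True)]"
    using assms i by (intro pres_eq.relation) (auto simp: braid_rels_def words_def)
  then show ?thesis
    using i by (simp add: braid_gen_def braid_group_def mult_presented_group words_def
      word_class_eq_iff)
qed

section \<open>Matrix representations\<close>

definition GL :: "('k::field^'r^'r) monoid" where
  "GL = \<lparr>carrier = {A. invertible A}, mult = (\<lambda>A B. A ** B), one = mat 1\<rparr>"

lemma group_GL: "Group.group (GL :: ('k::field^'r^'r) monoid)"
proof (rule groupI)
  fix A :: "'k^'r^'r" assume "A \<in> carrier GL"
  then obtain B where B: "A ** B = mat 1" "B ** A = mat 1"
    by (auto simp: GL_def invertible_def)
  then show "\<exists>B\<in>carrier GL. B \<otimes>\<^bsub>GL\<^esub> A = \<one>\<^bsub>GL\<^esub>"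
    by (auto simp: GL_def invertible_def)
qed (auto simp: GL_def invertible_mult matrix_mul_assoc invertible_def[of "mat 1"])

definition matrix_rep :: "('g, 'm) monoid_scheme \<Rightarrow> ('g \<Rightarrow> 'k::field^'r^'r) \<Rightarrow> bool" where
  "matrix_rep G \<rho> \<longleftrightarrow> Group.group G \<and> \<rho> \<in> hom G GL"

text \<open>The representation space is automatically nonzero, since the index type \<open>'r\<close> is nonempty.\<close>

definition irreducible_rep :: "('g, 'm) monoid_scheme \<Rightarrow> ('g \<Rightarrow> 'k::field^'r^'r) \<Rightarrow> bool" where
  "irreducible_rep G \<rho> \<longleftrightarrow> matrix_rep G \<rho> \<and>
    (\<forall>W. vec.subspace W \<and> (\<forall>g\<in>carrier G. \<forall>w\<in>W. \<rho> g *v w \<in> W) \<longrightarrow> W = {0} \<or> W = UNIV)"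

end

theory Submission
  imports Defs "HOL-Computational_Algebra.Fundamental_Theorem_Algebra"
begin

text \<open>
  Write \<open>A i = \<rho> \<sigma>\<^sub>i - 1\<close> and suppose that these operators have rank \<open>3\<close>. Generators far from \<open>\<sigma>\<^sub>i\<close>
  act on the \<open>3\<close>-dimensional space \<open>im (A i)\<close>, and a representation of dimension at most \<open>3\<close> of a braid
  group with at least seven generators sends all generators to the same operator. Hence
  \<open>A 1 \<circ> A j\<close> does not depend on \<open>j \<ge> 3\<close> and commutes with all generators, so it is zero by
  irreducibility, and by conjugation \<open>A i \<circ> A j = 0\<close> for all non-adjacent \<open>i\<close>, \<open>j\<close>.

  Let \<open>\<tau> = \<sigma>\<^sub>1 \<cdots> \<sigma>\<^sub>m\<close>, so that \<open>\<tau> \<sigma>\<^sub>i = \<sigma>\<^sub>i\<^sub>+\<^sub>1 \<tau>\<close>, and \<open>E = im (A 1)\<close>. A subspace \<open>S\<close> of \<open>E\<close> invariant under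
  \<open>X = A 1\<close>, \<open>P = A 1 \<circ> \<tau>\<^sup>-\<^sup>1\<close> and \<open>Q = A 1 \<circ> \<tau>\<close> spans, together with its translates by powers of
  \<open>\<tau>\<close>, an invariant subspace, which forces \<open>S = 0\<close> or \<open>S = E\<close>. The braid relations on \<open>E\<close> are so strong
  that a nonzero such \<open>S\<close> of dimension at most \<open>2\<close> always exists, whatever the dimension of \<open>E\<close>.
\<close>

section \<open>Eigenvectors modulo a subspace\<close>

abbreviation lin :: "('k::field^'r \<Rightarrow> 'k^'r) \<Rightarrow> bool" where
  "lin \<equiv> Vector_Spaces.linear (*s) (*s)"

lemma lin_funpow: "lin f \<Longrightarrow> lin (f ^^ k)"
  by (induction k) (simp_all add: vec.linear_id Vector_Spaces.linear_compose)

definition poly_op :: "'k::field poly \<Rightarrow> ('k^'r \<Rightarrow> 'k^'r) \<Rightarrow> 'k^'r \<Rightarrow> 'k^'r" where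
  "poly_op p f w = (\<Sum>i\<le>degree p. coeff p i *s (f ^^ i) w)"

lemma poly_op_eq:
  assumes "degree p \<le> N"
  shows "poly_op p f w = (\<Sum>i\<le>N. coeff p i *s (f ^^ i) w)"
  unfolding poly_op_def using assms
  by (intro sum.mono_neutral_left) (auto simp: coeff_eq_0)

text \<open>Peels a root off the polynomial by absorbing the factor X - l into the vector; the
  degree induction in \<open>eigenvector_mod_exists\<close> runs on this identity.\<close>

lemma poly_op_linear_factor:
  assumes "lin f"
  shows "poly_op ([:- l, 1:] * q) f w = poly_op q f (f w - l *s w)"
proof -
  let ?N = "degree q" and ?c = "coeff q"
  have lp: "(f ^^ i) (f w - l *s w) = (f ^^ Suc i) w - l *s (f ^^ i) w" for i
    using lin_funpow[OF assms, of i]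
    by (simp add: vec.linear_diff vec.linear_scale funpow_swap1)
  have co: "coeff ([:- l, 1:] * q) i = (case i of 0 \<Rightarrow> 0 | Suc j \<Rightarrow> ?c j) - l * ?c i" for i
    by (simp add: coeff_pCons split: nat.split)
  have "degree ([:- l, 1:] * q) \<le> Suc ?N"
    using degree_mult_le[of "[:- l, 1:]" q] by simp
  then have "poly_op ([:- l, 1:] * q) f w =
      (\<Sum>i\<le>Suc ?N. coeff ([:- l, 1:] * q) i *s (f ^^ i) w)"
    by (rule poly_op_eq)
  also have "\<dots> = (\<Sum>i\<le>Suc ?N. (case i of 0 \<Rightarrow> 0 | Suc j \<Rightarrow> ?c j) *s (f ^^ i) w) -
      (\<Sum>i\<le>Suc ?N. (l * ?c i) *s (f ^^ i) w)"
    by (simp only: co vec.scale_left_diff_distrib sum_subtractf)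
  also have "(\<Sum>i\<le>Suc ?N. (case i of 0 \<Rightarrow> 0 | Suc j \<Rightarrow> ?c j) *s (f ^^ i) w) =
      (\<Sum>i\<le>?N. ?c i *s (f ^^ Suc i) w)"
    by (subst sum.atMost_Suc_shift) simp
  also have "(\<Sum>i\<le>Suc ?N. (l * ?c i) *s (f ^^ i) w) = (\<Sum>i\<le>?N. (l * ?c i) *s (f ^^ i) w)"
    by (simp add: coeff_eq_0)
  also have "(\<Sum>i\<le>?N. ?c i *s (f ^^ Suc i) w) - (\<Sum>i\<le>?N. (l * ?c i) *s (f ^^ i) w) =
      poly_op q f (f w - l *s w)"
    unfolding poly_op_def lp sum_subtractf[symmetric]
    by (intro sum.cong HOL.refl) (simp add: vec.scale_right_diff_distrib mult.commute)
  finally show ?thesis .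
qed

text \<open>The N + 1 iterates up to exponent N = \<open>CARD('r)\<close> are dependent in dimension
  N. Dependence concerns sets of vectors, so a repetition among the iterates is a separate case,
  where a difference of two monomials annihilates \<open>w\<close>.\<close>

lemma annihilating_poly_exists: "\<exists>p. p \<noteq> 0 \<and> poly_op p f (w :: 'k::field^'r) = 0"
proof (cases "inj_on (\<lambda>i. (f ^^ i) w) {..CARD('r)}")
  case True
  let ?g = "\<lambda>i. (f ^^ i) w" and ?I = "{..CARD('r)}"
  have "vec.dim (?g ` ?I) < card (?g ` ?I)"
    using vec.dim_subset_UNIV[of "?g ` ?I"] card_image[OF True] by (simp add: vec.dimension_def card_cart_basis)
  then have "vec.dependent (?g ` ?I)"
    by (intro vec.dependent_biggerset_general) simp
  then obtain u where u: "\<exists>v\<in>?g ` ?I. u v \<noteq> 0" "(\<Sum>v\<in>?g ` ?I. u v *s v) = 0"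
    by (subst (asm) vec.dependent_finite) auto
  define p where "p = Poly (map (\<lambda>i. u (?g i)) [0..<Suc CARD('r)])"
  have c: "coeff p i = (if i \<le> CARD('r) then u (?g i) else 0)" for i
    unfolding p_def coeff_Poly_eq by (auto simp: nth_default_def nth_append simp del: upt_Suc)
  have "poly_op p f w = (\<Sum>i\<in>?I. u (?g i) *s ?g i)"
    using c by (subst poly_op_eq[of _ "CARD('r)"]) (auto intro!: degree_le)
  also have "\<dots> = 0"
    using u(2) sum.reindex[OF True, of "\<lambda>v. u v *s v"] by simp
  finally have "poly_op p f w = 0" .
  moreover have "p \<noteq> 0"
    using u(1) c by (metis (no_types, lifting) atMost_iff coeff_0 image_iff)
  ultimately show ?thesis by blast
next
  case False
  then obtain i j where ij: "(f ^^ i) w = (f ^^ j) w" "i < j"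
    by (auto simp: inj_on_def) (metis linorder_neqE_nat)
  define p where "p = monom (1::'k) j - monom 1 i"
  have c: "coeff p k = (if k = j then 1 else 0) - (if k = i then 1 else 0)" for k
    by (auto simp: p_def)
  have "poly_op p f w = (\<Sum>k\<le>j. coeff p k *s (f ^^ k) w)"
    using ij(2) c by (intro poly_op_eq degree_le) auto
  also have "\<dots> = (\<Sum>k\<le>j. if k = j then (f ^^ k) w else 0) - (\<Sum>k\<le>j. if k = i then (f ^^ k) w else 0)"
    by (subst sum_subtractf[symmetric], rule sum.cong) (auto simp: c)
  also have "\<dots> = 0"
    using ij by simp
  finally have "poly_op p f w = 0" .
  moreover have "p \<noteq> 0"
    using c[of j] ij(2) by auto
  ultimately show ?thesis by blast
qed

text \<open>An eigenvector modulo \<open>U\<close>, found without forming a quotient. Starting from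
  p(f) w in \<open>U\<close>, strip linear factors off p: either \<open>f w - l *s w\<close> falls
  into \<open>U\<close>, or it replaces \<open>w\<close> and the degree drops. A nonzero constant p
  would put \<open>w\<close> itself into \<open>U\<close>.\<close>

lemma eigenvector_mod_exists:
  fixes f :: "complex^'r \<Rightarrow> complex^'r"
  assumes f: "lin f" and U: "vec.subspace U" and W: "vec.subspace W" and fW: "f ` W \<subseteq> W"
    and "w \<in> W" "w \<notin> U"
  shows "\<exists>l. \<exists>v\<in>W. v \<notin> U \<and> f v - l *s v \<in> U"
proof -
  obtain p where "p \<noteq> 0" "poly_op p f w = 0"
    using annihilating_poly_exists by blast
  then have "p \<noteq> 0" "poly_op p f w \<in> U"
    using U by (simp_all add: vec.subspace_0)
  with \<open>w \<in> W\<close> \<open>w \<notin> U\<close> show ?thesis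
  proof (induction "degree p" arbitrary: p w)
    case 0
    then obtain c where "p = [:c:]" "c \<noteq> 0"
      by (metis degree_eq_zeroE pCons_0_0)
    with 0 have "c *s w \<in> U" by (simp add: poly_op_def)
    from vec.subspace_scale[OF U this, of "inverse c"] 0 \<open>c \<noteq> 0\<close> show ?case
      by simp
  next
    case (Suc d)
    then have "\<not> constant (poly p)"
      by (metis constant_degree nat.distinct(1))
    then obtain l where "poly p l = 0"
      using fundamental_theorem_of_algebra by blast
    then obtain q where q: "p = [:- l, 1:] * q"
      by (auto simp: poly_eq_0_iff_dvd)
    with Suc.prems have q0: "q \<noteq> 0" by auto
    then have "d = degree q"
      using Suc.hyps(2) unfolding q by (subst (asm) degree_mult_eq) auto
    show ?case
    proof (cases "f w - l *s w \<in> U")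
      case True
      then show ?thesis using Suc.prems by blast
    next
      case False
      have "f w - l *s w \<in> W"
        using fW W Suc.prems(1) by (intro vec.subspace_diff vec.subspace_scale) auto
      with False show ?thesis
        using Suc.hyps(1)[OF \<open>d = degree q\<close>, of "f w - l *s w"] q0
          Suc.prems(4)[unfolded q poly_op_linear_factor[OF f]] by blast
    qed
  qed
qed

section \<open>Braided families of operators\<close>

definition braided :: "nat set \<Rightarrow> (nat \<Rightarrow> 'k::field^'r \<Rightarrow> 'k^'r) \<Rightarrow> bool" where
  "braided I s \<longleftrightarrow> (\<forall>i\<in>I. lin (s i) \<and> bij (s i)) \<and>
    (\<forall>i\<in>I. \<forall>j\<in>I. i + 2 \<le> j \<longrightarrow> (\<forall>v. s i (s j v) = s j (s i v))) \<and>
    (\<forall>i\<in>I. Suc i \<in> I \<longrightarrow> (\<forall>v. s i (s (Suc i) (s i v)) = s (Suc i) (s i (s (Suc i) v))))"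

definition stable_under :: "nat set \<Rightarrow> (nat \<Rightarrow> 'k::field^'r \<Rightarrow> 'k^'r) \<Rightarrow> ('k^'r) set \<Rightarrow> bool" where
  "stable_under I s U \<longleftrightarrow> vec.subspace U \<and> (\<forall>i\<in>I. \<forall>u\<in>U. s i u \<in> U)"

text \<open>Equality of two maps from \<open>W\<close> to the quotient by \<open>U\<close>, encoded
  as a congruence so that no quotient space has to be built.\<close>

definition eq_mod :: "('k::field^'r) set \<Rightarrow> ('k^'r) set \<Rightarrow> ('k^'r \<Rightarrow> 'k^'r) \<Rightarrow> ('k^'r \<Rightarrow> 'k^'r) \<Rightarrow> bool"
  where "eq_mod W U f g \<longleftrightarrow> (\<forall>w\<in>W. f w - g w \<in> U)"

definition commute_mod :: "('k::field^'r) set \<Rightarrow> ('k^'r) set \<Rightarrow> ('k^'r \<Rightarrow> 'k^'r) \<Rightarrow> ('k^'r \<Rightarrow> 'k^'r) \<Rightarrow> bool"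
  where "commute_mod W U f g \<longleftrightarrow> eq_mod W U (\<lambda>w. f (g w)) (\<lambda>w. g (f w))"

lemma braided_subset: "braided I s \<Longrightarrow> J \<subseteq> I \<Longrightarrow> braided J s"
  unfolding braided_def by blast

lemma stable_subset: "stable_under I s U \<Longrightarrow> J \<subseteq> I \<Longrightarrow> stable_under J s U"
  unfolding stable_under_def by blast

lemma stableD: "stable_under I s U \<Longrightarrow> i \<in> I \<Longrightarrow> u \<in> U \<Longrightarrow> s i u \<in> U"
  and stable_subspace: "stable_under I s U \<Longrightarrow> vec.subspace U"
  unfolding stable_under_def by blast+

lemma stable_image: "stable_under I s U \<Longrightarrow> i \<in> I \<Longrightarrow> s i ` U \<subseteq> U"
  unfolding stable_under_def by blast

lemma braided_lin: "braided I s \<Longrightarrow> i \<in> I \<Longrightarrow> lin (s i)"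
  and braided_bij: "braided I s \<Longrightarrow> i \<in> I \<Longrightarrow> bij (s i)"
  and braided_braid: "braided I s \<Longrightarrow> i \<in> I \<Longrightarrow> Suc i \<in> I \<Longrightarrow>
    s i (s (Suc i) (s i v)) = s (Suc i) (s i (s (Suc i) v))"
  unfolding braided_def by blast+

lemma braided_commute:
  "braided I s \<Longrightarrow> i \<in> I \<Longrightarrow> j \<in> I \<Longrightarrow> i + 2 \<le> j \<or> j + 2 \<le> i \<Longrightarrow> s i (s j v) = s j (s i v)"
  unfolding braided_def by metis

lemma eq_mod_sym: "vec.subspace U \<Longrightarrow> eq_mod W U f g \<Longrightarrow> eq_mod W U g f"
  unfolding eq_mod_def by (metis minus_diff_eq vec.subspace_neg)

lemma eq_mod_trans:
  assumes "vec.subspace U" "eq_mod W U f g" "eq_mod W U g h" shows "eq_mod W U f h"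
  unfolding eq_mod_def
proof
  fix w assume "w \<in> W"
  then have "(f w - g w) + (g w - h w) \<in> U"
    using assms unfolding eq_mod_def by (intro vec.subspace_add) auto
  then show "f w - h w \<in> U" by simp
qed

lemma commute_mod_sym: "vec.subspace U \<Longrightarrow> commute_mod W U f g \<Longrightarrow> commute_mod W U g f"
  unfolding commute_mod_def by (rule eq_mod_sym)

text \<open>By dimension \<open>f\<close> maps \<open>U\<close> onto \<open>U\<close>, so
  \<open>f v\<close> is also the image of an element of \<open>U\<close>, which is \<open>v\<close>
  by injectivity. This permits cancelling generators modulo a stable subspace.\<close>

lemma inj_lin_reflects_stable_subspace:
  assumes f: "lin f" "inj f" and U: "vec.subspace U" "\<And>u. u \<in> U \<Longrightarrow> f u \<in> U" and v: "f v \<in> U"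
  shows "v \<in> U"
proof -
  have "vec.dim (f ` U) = vec.dim U"
    using f by (intro vec.dim_image_eq) (auto intro: inj_on_subset)
  moreover have "vec.subspace (f ` U)"
    using f(1) U(1) by (rule vec.linear_subspace_image)
  ultimately have "f ` U = U"
    using U by (intro vec.subspace_dim_equal) auto
  then show ?thesis
    using v f(2) by (metis image_iff injD)
qed

text \<open>In a group, ab = ba and aba = bab give a = b. The same cancellation works modulo
  \<open>U\<close>, because the generators reflect membership in \<open>U\<close>.\<close>

lemma eq_mod_of_commute_mod:
  assumes br: "braided I s" and W: "stable_under I s W" and U: "stable_under I s U"
    and i: "i \<in> I" "Suc i \<in> I" and co: "commute_mod W U (s i) (s (Suc i))"
  shows "eq_mod W U (s i) (s (Suc i))"
  unfolding eq_mod_def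
proof
  fix w assume w: "w \<in> W"
  let ?a = "s i" and ?b = "s (Suc i)"
  have a: "lin ?a" "inj ?a" and b: "lin ?b" "inj ?b"
    using braided_lin[OF br] braided_bij[OF br] i bij_is_inj by blast+
  have sU: "vec.subspace U" using U by (rule stable_subspace)
  have com: "?a (?b x) - ?b (?a x) \<in> U" if "x \<in> W" for x
    using co that unfolding commute_mod_def eq_mod_def by blast
  \<comment> \<open>Two instances of the commutator, at \<open>w\<close> after applying
    \<open>?a\<close> and at \<open>?b w\<close>, turn aba = bab into aab = abb modulo
    \<open>U\<close>.\<close>
  have "?a (?a (?b w) - ?b (?a w)) - (?a (?b (?b w)) - ?b (?a (?b w))) \<in> U"
    by (rule vec.subspace_diff[OF sU stableD[OF U i(1) com[OF w]] com[OF stableD[OF W i(2) w]]])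
  then have "?a (?a (?b w) - ?b (?b w)) \<in> U"
    using braided_braid[OF br i, of w] by (simp add: vec.linear_diff[OF a(1)] algebra_simps)
  then have "?a (?b w) - ?b (?b w) \<in> U"
    using inj_lin_reflects_stable_subspace[OF a sU] stableD[OF U i(1)] by blast
  then have "(?a (?b w) - ?b (?b w)) - (?a (?b w) - ?b (?a w)) \<in> U"
    using com[OF w] by (rule vec.subspace_diff[OF sU])
  then have "?b (?a w - ?b w) \<in> U"
    by (simp add: vec.linear_diff[OF b(1)])
  then show "?a w - ?b w \<in> U"
    using inj_lin_reflects_stable_subspace[OF b sU] stableD[OF U i(2)] by blast
qed

text \<open>Exact commutation with \<open>f\<close> becomes commutation modulo \<open>U\<close> with
  every \<open>g\<close> congruent to \<open>f\<close>. In the applications \<open>c\<close> is a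
  generator far from \<open>f\<close> but adjacent to \<open>g\<close>.\<close>

lemma commute_mod_transfer:
  assumes U: "vec.subspace U" "c ` U \<subseteq> U" and W: "c ` W \<subseteq> W"
    and c: "lin c" "\<And>w. f (c w) = c (f w)" and fg: "eq_mod W U f g"
  shows "commute_mod W U g c"
  unfolding commute_mod_def eq_mod_def
proof
  fix w assume "w \<in> W"
  then have "c (f w - g w) \<in> U" "f (c w) - g (c w) \<in> U"
    using fg U W unfolding eq_mod_def by auto
  then have "c (f w - g w) - (f (c w) - g (c w)) \<in> U"
    by (rule vec.subspace_diff[OF U(1)])
  then show "g (c w) - c (g w) \<in> U"
    by (simp add: vec.linear_diff[OF c(1)] c(2))
qed

lemma commute_mod_scalar:
  assumes U: "vec.subspace U" "g ` U \<subseteq> U" and W: "g ` W \<subseteq> W"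
    and g: "lin g" and f: "eq_mod W U f ((*s) l)"
  shows "commute_mod W U f g"
  unfolding commute_mod_def eq_mod_def
proof
  fix w assume "w \<in> W"
  then have "f (g w) - l *s g w \<in> U" "g (f w - l *s w) \<in> U"
    using f U W unfolding eq_mod_def by auto
  then have "(f (g w) - l *s g w) - g (f w - l *s w) \<in> U"
    by (rule vec.subspace_diff[OF U(1)])
  then show "f (g w) - g (f w) \<in> U"
    by (simp add: vec.linear_diff[OF g] vec.linear_scale[OF g])
qed

section \<open>Propagation of agreement between generators along an interval\<close>

definition agree :: "nat set \<Rightarrow> (nat \<Rightarrow> 'k::field^'r \<Rightarrow> 'k^'r) \<Rightarrow> ('k^'r) set \<Rightarrow> ('k^'r) set \<Rightarrow> bool"
  where "agree I s W U \<longleftrightarrow> (\<forall>i\<in>I. \<forall>j\<in>I. eq_mod W U (s i) (s j))"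

lemma agreeD: "agree I s W U \<Longrightarrow> i \<in> I \<Longrightarrow> j \<in> I \<Longrightarrow> w \<in> W \<Longrightarrow> s i w - s j w \<in> U"
  unfolding agree_def eq_mod_def by blast

text \<open>The first generator commutes with the third, hence so does the second modulo
  \<open>U\<close>, and neighbours that commute modulo \<open>U\<close> coincide there.\<close>

lemma eq_mod_succ_up:
  assumes br: "braided I s" and W: "stable_under I s W" and U: "stable_under I s U"
    and i: "i \<in> I" "Suc i \<in> I" "Suc (Suc i) \<in> I" and eq: "eq_mod W U (s i) (s (Suc i))"
  shows "eq_mod W U (s (Suc i)) (s (Suc (Suc i)))"
proof (rule eq_mod_of_commute_mod[OF br W U i(2,3)])
  show "commute_mod W U (s (Suc i)) (s (Suc (Suc i)))"
    using i by (intro commute_mod_transfer[OF _ _ _ _ _ eq] stable_subspace[OF U]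
        stable_image[OF U] stable_image[OF W] braided_lin[OF br] braided_commute[OF br]) auto
qed

lemma eq_mod_succ_down:
  assumes br: "braided I s" and W: "stable_under I s W" and U: "stable_under I s U"
    and i: "i \<in> I" "Suc i \<in> I" "Suc (Suc i) \<in> I"
    and eq: "eq_mod W U (s (Suc i)) (s (Suc (Suc i)))"
  shows "eq_mod W U (s i) (s (Suc i))"
proof (rule eq_mod_of_commute_mod[OF br W U i(1,2)])
  note sU = stable_subspace[OF U]
  show "commute_mod W U (s i) (s (Suc i))"
    using i by (rule_tac commute_mod_sym[OF sU], intro commute_mod_transfer[OF _ _ _ _ _ eq_mod_sym[OF sU eq]]
        sU stable_image[OF U] stable_image[OF W] braided_lin[OF br] braided_commute[OF br]) auto
qed

lemma agree_of_adjacent: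
  assumes br: "braided {a..b} s" and W: "stable_under {a..b} s W" and U: "stable_under {a..b} s U"
    and k: "a \<le> k" "Suc k \<le> b" "eq_mod W U (s k) (s (Suc k))"
  shows "agree {a..b} s W U"
proof -
  note sU = stable_subspace[OF U]
  have up: "Suc i \<le> b \<longrightarrow> eq_mod W U (s i) (s (Suc i))" if "k \<le> i" for i
    using that
  proof (induction i rule: dec_induct)
    case base
    then show ?case using k by simp
  next
    case (step i)
    then show ?case
      using k(1) eq_mod_succ_up[OF br W U, of i] by simp
  qed
  have down: "a \<le> i \<longrightarrow> eq_mod W U (s i) (s (Suc i))" if "i \<le> k" for i
    using that
  proof (induction i rule: inc_induct)
    case base
    then show ?case using k by simp
  next
    case (step i)
    then show ?case
      using k(2) eq_mod_succ_down[OF br W U, of i] by simp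
  qed
  have adj: "eq_mod W U (s i) (s (Suc i))" if "a \<le> i" "Suc i \<le> b" for i
    using up down that by (metis nat_le_linear)
  have first: "i \<le> b \<longrightarrow> eq_mod W U (s a) (s i)" if "a \<le> i" for i
    using that
  proof (induction i rule: dec_induct)
    case base
    then show ?case using sU by (simp add: eq_mod_def vec.subspace_0)
  next
    case (step i)
    then show ?case using eq_mod_trans[OF sU _ adj[of i]] by simp
  qed
  have "eq_mod W U (s i) (s j)" if "i \<in> {a..b}" "j \<in> {a..b}" for i j
  proof -
    have "eq_mod W U (s a) (s i)" "eq_mod W U (s a) (s j)"
      using first that by simp_all
    then show ?thesis
      by (rule eq_mod_trans[OF sU eq_mod_sym[OF sU]])
  qed
  then show ?thesis unfolding agree_def by blast
qed

lemma agree_of_commute_first: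
  assumes br: "braided {a..b} s" and W: "stable_under {a..b} s W" and U: "stable_under {a..b} s U"
    and c: "a < b \<Longrightarrow> commute_mod W U (s a) (s (Suc a))"
  shows "agree {a..b} s W U"
proof (cases "a < b")
  case True
  then have I: "a \<in> {a..b}" "Suc a \<in> {a..b}" by auto
  have "eq_mod W U (s a) (s (Suc a))"
    by (rule eq_mod_of_commute_mod[OF br W U I c[OF True]])
  then show ?thesis
    using True by (intro agree_of_adjacent[OF br W U order_refl]) simp_all
next
  case False
  have "s i w - s j w \<in> U" if "i \<in> {a..b}" "j \<in> {a..b}" for i j w
  proof -
    have "i = j" using False that by simp
    then show ?thesis using vec.subspace_0[OF stable_subspace[OF U]] by simp
  qed
  then show ?thesis
    unfolding agree_def eq_mod_def by blast
qed

text \<open>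
  The products \<open>(s i - s k) (s j - s k)\<close> and \<open>(s j - s k) (s i - s k)\<close> vanish modulo \<open>U\<close>;
  their difference is the commutator of \<open>s i\<close> and \<open>s j\<close> once \<open>s k\<close> commutes with both.
\<close>

lemma agree_extension:
  assumes br: "braided {a..b} s" and W: "stable_under {a..b} s W" and M: "stable_under {a..b} s M"
    and U: "stable_under {a..b} s U" and b: "a + 3 \<le> b"
    and WM: "agree {a..b} s W M" and MU: "agree {a..b} s M U"
  shows "agree {a..b} s W U"
proof (rule agree_of_commute_first[OF br W U])
  \<comment> \<open>The index \<open>a + 3\<close> is the first one above these that is at distance
    at least two from both \<open>a\<close> and \<open>Suc a\<close>.\<close>
  let ?i = "a" and ?j = "Suc a" and ?k = "a + 3"
  have I: "?i \<in> {a..b}" "?j \<in> {a..b}" "?k \<in> {a..b}" using b by auto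
  note sU = stable_subspace[OF U] and lin = braided_lin[OF br]
  show "commute_mod W U (s ?i) (s ?j)"
    unfolding commute_mod_def eq_mod_def
  proof
    fix w assume w: "w \<in> W"
    note d = agreeD[OF MU _ _ agreeD[OF WM _ _ w]]
    have "(s ?i (s ?j w - s ?k w) - s ?k (s ?j w - s ?k w)) -
        (s ?j (s ?i w - s ?k w) - s ?k (s ?i w - s ?k w)) \<in> U"
      by (rule vec.subspace_diff[OF sU d d]) (use I in auto)
    moreover have "s ?i (s ?k w) = s ?k (s ?i w)" "s ?j (s ?k w) = s ?k (s ?j w)"
      using I by (auto intro!: braided_commute[OF br])
    ultimately show "s ?i (s ?j w) - s ?j (s ?i w) \<in> U"
      using lin[OF I(1)] lin[OF I(2)] lin[OF I(3)] by (simp add: vec.linear_diff)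
  qed
qed

section \<open>Agreement on subquotients of dimension at most three\<close>

definition eigen_mod :: "('k::field^'r \<Rightarrow> 'k^'r) \<Rightarrow> 'k \<Rightarrow> ('k^'r) set \<Rightarrow> ('k^'r) set \<Rightarrow> ('k^'r) set"
  where "eigen_mod f l W U = {v \<in> W. f v - l *s v \<in> U}"

lemma subspace_eigen_mod:
  assumes "lin f" "vec.subspace W" "vec.subspace U"
  shows "vec.subspace (eigen_mod f l W U)"
proof -
  have "lin (\<lambda>v. f v - l *s v)"
    using assms(1) by (intro vec.linear_compose_sub vec.linear_scale_self)
  then have "vec.subspace {v. f v - l *s v \<in> U}"
    using assms(3) vec.linear_subspace_vimage[of "\<lambda>v. f v - l *s v" U] by (simp add: vimage_def)
  then have "vec.subspace (W \<inter> {v. f v - l *s v \<in> U})"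
    using assms(2) by (rule vec.subspace_inter[rotated])
  then show ?thesis by (simp add: eigen_mod_def Int_def)
qed

lemma subset_eigen_mod:
  assumes "vec.subspace U" "U \<subseteq> W" "f ` U \<subseteq> U"
  shows "U \<subseteq> eigen_mod f l W U"
  unfolding eigen_mod_def using assms by (auto intro!: vec.subspace_diff vec.subspace_scale)

lemma dim_less_of_psubset:
  assumes "vec.subspace (S :: ('k::field^'r) set)" "vec.subspace T" "S \<subset> T"
  shows "vec.dim S < vec.dim T"
  using assms by (metis vec.dim_psubset vec.span_eq_iff)

text \<open>An eigenvector modulo \<open>U\<close> makes the corresponding eigenspace strictly
  larger than \<open>U\<close>, so with at most one dimension to spare it is all of
  \<open>W\<close>.\<close>

lemma scalar_mod_of_dim_le:
  fixes f :: "complex^'r \<Rightarrow> complex^'r"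
  assumes f: "lin f" and W: "vec.subspace W" "f ` W \<subseteq> W"
    and U: "vec.subspace U" "f ` U \<subseteq> U" "U \<subseteq> W" and d: "vec.dim W \<le> vec.dim U + 1"
  shows "\<exists>l. eq_mod W U f ((*s) l)"
proof (cases "W = U")
  case True
  then show ?thesis
    using W by (intro exI[of _ 0]) (auto simp: eq_mod_def)
next
  case False
  then obtain l v where v: "v \<in> W" "v \<notin> U" "f v - l *s v \<in> U"
    using eigenvector_mod_exists[OF f U(1) W(1)] W(2) U(3) by blast
  let ?K = "eigen_mod f l W U"
  have K: "vec.subspace ?K" by (rule subspace_eigen_mod[OF f W(1) U(1)])
  have "U \<subset> ?K"
    using v subset_eigen_mod[OF U(1,3,2), of l] by (auto simp: eigen_mod_def)
  then have "vec.dim U < vec.dim ?K"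
    by (rule dim_less_of_psubset[OF U(1) K])
  then have "?K = W"
    using d by (intro vec.subspace_dim_equal K W) (auto simp: eigen_mod_def)
  then show ?thesis
    unfolding eq_mod_def eigen_mod_def by blast
qed

lemma agree_of_dim_le_1:
  fixes s :: "nat \<Rightarrow> complex^'r \<Rightarrow> complex^'r"
  assumes br: "braided {a..b} s" and W: "stable_under {a..b} s W" and U: "stable_under {a..b} s U"
    and UW: "U \<subseteq> W" "vec.dim W \<le> vec.dim U + 1"
  shows "agree {a..b} s W U"
proof (rule agree_of_commute_first[OF br W U])
  assume "a < b"
  then have I: "a \<in> {a..b}" "Suc a \<in> {a..b}" by auto
  note sU = stable_subspace[OF U] and sW = stable_subspace[OF W]
  obtain l where "eq_mod W U (s a) ((*s) l)"
    using scalar_mod_of_dim_le[OF braided_lin[OF br I(1)] sW stable_image[OF W I(1)] sU stable_image[OF U I(1)] UW]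
    by blast
  then show "commute_mod W U (s a) (s (Suc a))"
    by (rule commute_mod_scalar[OF sU stable_image[OF U I(2)] stable_image[OF W I(2)] braided_lin[OF br I(2)]])
qed

text \<open>Take an eigenspace of \<open>s a\<close> modulo \<open>U\<close>. The generators from
  \<open>a + 2\<close> on commute with \<open>s a\<close> and preserve it. If it is all of
  \<open>W\<close>, then \<open>s a\<close> is scalar modulo \<open>U\<close> and commutes with its
  neighbour; otherwise it is the intermediate space.\<close>

lemma agree_or_intermediate:
  fixes s :: "nat \<Rightarrow> complex^'r \<Rightarrow> complex^'r"
  assumes br: "braided {a..b} s" and W: "stable_under {a..b} s W" and U: "stable_under {a..b} s U"
    and UW: "U \<subset> W" and ab: "a \<le> b"
  shows "agree {a..b} s W U \<or> (\<exists>K. stable_under {a+2..b} s K \<and> U \<subset> K \<and> K \<subset> W)"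
proof -
  note sU = stable_subspace[OF U] and sW = stable_subspace[OF W]
  have a: "a \<in> {a..b}" using ab by auto
  note f = braided_lin[OF br a]
  obtain w where "w \<in> W" "w \<notin> U" using UW by blast
  then obtain l v where v: "v \<in> W" "v \<notin> U" "s a v - l *s v \<in> U"
    using eigenvector_mod_exists[OF f sU sW] stableD[OF W a] by blast
  let ?K = "eigen_mod (s a) l W U"
  have UK: "U \<subset> ?K"
    using v UW subset_eigen_mod[OF sU _ stable_image[OF U a], of W l] by (auto simp: eigen_mod_def)
  show ?thesis
  proof (cases "?K = W")
    case True
    then have "eq_mod W U (s a) ((*s) l)"
      by (auto simp: eigen_mod_def eq_mod_def)
    then have "agree {a..b} s W U"
      by (intro agree_of_commute_first[OF br W U] commute_mod_scalar[OF sU])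
        (auto intro!: stable_image[OF U] stable_image[OF W] braided_lin[OF br])
    then show ?thesis ..
  next
    case False
    have "s i v \<in> ?K" if i: "i \<in> {a+2..b}" and v: "v \<in> ?K" for i v
    proof -
      have i': "i \<in> {a..b}" using i by auto
      have "s i (s a v - l *s v) \<in> U"
        using v by (intro stableD[OF U i']) (simp add: eigen_mod_def)
      moreover have "s i (s a v) = s a (s i v)"
        using i a i' by (intro braided_commute[OF br]) auto
      ultimately show ?thesis
        using stableD[OF W i'] v braided_lin[OF br i']
        by (simp add: eigen_mod_def vec.linear_diff vec.linear_scale)
    qed
    then have "stable_under {a+2..b} s ?K"
      using subspace_eigen_mod[OF f sW sU] unfolding stable_under_def by blast
    moreover have "?K \<subset> W"
      using False by (auto simp: eigen_mod_def)
    ultimately show ?thesis using UK by blast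
  qed
qed

lemma agree_of_dim_le_2:
  fixes s :: "nat \<Rightarrow> complex^'r \<Rightarrow> complex^'r"
  assumes br: "braided {a..b} s" and W: "stable_under {a..b} s W" and U: "stable_under {a..b} s U"
    and UW: "U \<subseteq> W" "vec.dim W \<le> vec.dim U + 2" and b: "a + 4 \<le> b"
  shows "agree {a..b} s W U"
proof (cases "agree {a..b} s W U \<or> U = W")
  case True
  then show ?thesis
    using agree_of_dim_le_1[OF br W U UW(1)] by auto
next
  case False
  \<comment> \<open>The intermediate space is stable only from \<open>i\<close> on. The index
    \<open>k\<close> commutes with \<open>i\<close> and also with \<open>a + 1\<close>, the
    neighbour of \<open>i\<close> on the other side.\<close>
  define i k where "i = a + 2" and "k = a + 4"
  have I: "i \<in> {i..b}" "Suc i \<in> {i..b}" "k \<in> {i..b}"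
    and Ia: "a + 1 \<in> {a..b}" "i \<in> {a..b}" "k \<in> {a..b}" and sub: "{i..b} \<subseteq> {a..b}"
    using b by (auto simp: i_def k_def)
  note sU = stable_subspace[OF U] and sW = stable_subspace[OF W]
  obtain K where K: "stable_under {i..b} s K" "U \<subset> K" "K \<subset> W"
    using False agree_or_intermediate[OF br W U] UW(1) b unfolding i_def by auto
  note sK = stable_subspace[OF K(1)]
  note br' = braided_subset[OF br sub] and W' = stable_subset[OF W sub] and U' = stable_subset[OF U sub]
  have "vec.dim U < vec.dim K" "vec.dim K < vec.dim W"
    using dim_less_of_psubset K sU sW sK by blast+
  then have d: "vec.dim K \<le> vec.dim U + 1" "vec.dim W \<le> vec.dim K + 1"
    using UW(2) by linarith+
  have KU: "agree {i..b} s K U" and WK: "agree {i..b} s W K"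
    using agree_of_dim_le_1[OF br' K(1) U' _ d(1)] agree_of_dim_le_1[OF br' W' K(1) _ d(2)] K by auto
  note f = braided_lin[OF br']
  obtain m where m: "eq_mod K U (s i) ((*s) m)"
    using scalar_mod_of_dim_le[OF f[OF I(1)] sK stable_image[OF K(1) I(1)] sU stable_image[OF U' I(1)] _ d(1)]
      K(2) by blast
  obtain n where n: "eq_mod W K (s i) ((*s) n)"
    using scalar_mod_of_dim_le[OF f[OF I(1)] sW stable_image[OF W' I(1)] sK stable_image[OF K(1) I(1)] _ d(2)]
      K(3) by blast
  show ?thesis
  \<comment> \<open>On the layers \<open>K\<close> modulo \<open>U\<close> and \<open>W\<close>
    modulo \<open>K\<close>, all generators from \<open>i\<close> on act by \<open>m\<close> and
    \<open>n\<close> respectively. If these are equal, a product of two operators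
    \<open>s j - m\<close> sends \<open>W\<close> into \<open>U\<close>, so the commutator does as
    well.\<close>
  proof (cases "m = n")
    case True
    have mK: "s j x - m *s x \<in> U" if "j \<in> {i..b}" "x \<in> K" for j x
    proof -
      have "(s j x - s i x) + (s i x - m *s x) \<in> U"
        using m agreeD[OF KU that(1) I(1) that(2)] that
        by (intro vec.subspace_add sU) (auto simp: eq_mod_def)
      then show ?thesis by simp
    qed
    have mW: "s j x - m *s x \<in> K" if "j \<in> {i..b}" "x \<in> W" for j x
    proof -
      have "(s j x - s i x) + (s i x - n *s x) \<in> K"
        using n agreeD[OF WK that(1) I(1) that(2)] that
        by (intro vec.subspace_add sK) (auto simp: eq_mod_def)
      then show ?thesis using True by simp
    qed
    have "commute_mod W U (s i) (s (Suc i))"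
      unfolding commute_mod_def eq_mod_def
    proof
      fix w assume w: "w \<in> W"
      have "(s i (s (Suc i) w - m *s w) - m *s (s (Suc i) w - m *s w)) -
          (s (Suc i) (s i w - m *s w) - m *s (s i w - m *s w)) \<in> U"
        by (rule vec.subspace_diff[OF sU mK[OF I(1) mW[OF I(2) w]] mK[OF I(2) mW[OF I(1) w]]])
      then show "s i (s (Suc i) w) - s (Suc i) (s i w) \<in> U"
        using f[OF I(1)] f[OF I(2)]
        by (simp add: vec.linear_diff vec.linear_scale vec.scale_right_diff_distrib)
    qed
    then have "eq_mod W U (s i) (s (Suc i))"
      by (rule eq_mod_of_commute_mod[OF br' W' U' I(1,2)])
    then show ?thesis
      using I by (intro agree_of_adjacent[OF br W U, of i]) (simp_all add: i_def)
  next
    case False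
    have "s i w - s k w \<in> U" if w: "w \<in> W" for w
    proof -
      \<comment> \<open>\<open>?D\<close> maps \<open>W\<close> into \<open>K\<close> and
        \<open>K\<close> into \<open>U\<close>, and it commutes with \<open>s i\<close>. Modulo
        \<open>U\<close>, \<open>s i (?D w)\<close> is therefore both \<open>m\<close> and
        \<open>n\<close> times \<open>?D w\<close>, which forces \<open>?D w\<close> into
        \<open>U\<close>.\<close>
      let ?D = "\<lambda>x. s i x - s k x"
      have "s i (?D w) - m *s ?D w \<in> U"
        using m agreeD[OF WK I(1,3) w] by (auto simp: eq_mod_def)
      moreover have "?D (s i w - n *s w) \<in> U"
        using n w agreeD[OF KU I(1,3)] by (auto simp: eq_mod_def)
      moreover have "?D (s i w - n *s w) = s i (?D w) - n *s ?D w"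
        using f[OF I(1)] f[OF I(3)] braided_commute[OF br Ia(2,3)]
        by (simp add: vec.linear_diff vec.linear_scale vec.scale_right_diff_distrib i_def k_def)
      ultimately have "(s i (?D w) - m *s ?D w) - (s i (?D w) - n *s ?D w) \<in> U"
        using vec.subspace_diff[OF sU] by metis
      then have "(n - m) *s ?D w \<in> U"
        by (simp add: vec.scale_left_diff_distrib vec.scale_right_diff_distrib algebra_simps)
      from vec.subspace_scale[OF sU this, of "inverse (n - m)"]
      have "(inverse (n - m) * (n - m)) *s ?D w \<in> U"
        by (simp only: vec.scale_scale)
      moreover have "inverse (n - m) * (n - m) = 1"
        using False by simp
      ultimately show ?thesis
        by (simp only: vec.scale_one)
    qed
    then have ki: "eq_mod W U (s k) (s i)"
      by (rule_tac eq_mod_sym[OF sU]) (simp add: eq_mod_def)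
    have "commute_mod W U (s i) (s (a + 1))"
      using Ia b by (intro commute_mod_transfer[OF sU _ _ _ _ ki] stable_image[OF U] stable_image[OF W]
          braided_lin[OF br] braided_commute[OF br]) (auto simp: k_def)
    from commute_mod_sym[OF sU this] have "commute_mod W U (s (a + 1)) (s (Suc (a + 1)))"
      by (simp add: i_def)
    then have "eq_mod W U (s (a + 1)) (s (Suc (a + 1)))"
      using b by (rule_tac eq_mod_of_commute_mod[OF br W U]) auto
    then show ?thesis
      using b by (intro agree_of_adjacent[OF br W U, of "a + 1"]) simp_all
  qed
qed

text \<open>An intermediate space splits the subquotient into two layers of dimension at most two.
  Both have agreement from \<open>a + 2\<close> on, \<open>agree_extension\<close> glues them, and
  one adjacent pair carries the agreement back to \<open>a\<close>.\<close>

lemma agree_of_dim_le_3: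
  fixes s :: "nat \<Rightarrow> complex^'r \<Rightarrow> complex^'r"
  assumes br: "braided {a..b} s" and W: "stable_under {a..b} s W" and U: "stable_under {a..b} s U"
    and UW: "U \<subseteq> W" "vec.dim W \<le> vec.dim U + 3" and b: "a + 6 \<le> b"
  shows "agree {a..b} s W U"
proof (cases "agree {a..b} s W U \<or> U = W")
  case True
  then show ?thesis
    using agree_of_dim_le_1[OF br W U UW(1)] by auto
next
  case False
  have sub: "{a+2..b} \<subseteq> {a..b}" by auto
  note sU = stable_subspace[OF U] and sW = stable_subspace[OF W]
  obtain K where K: "stable_under {a+2..b} s K" "U \<subset> K" "K \<subset> W"
    using False agree_or_intermediate[OF br W U] UW(1) b by auto
  note sK = stable_subspace[OF K(1)]
  note br' = braided_subset[OF br sub] and W' = stable_subset[OF W sub] and U' = stable_subset[OF U sub]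
  have "vec.dim U < vec.dim K" "vec.dim K < vec.dim W"
    using dim_less_of_psubset K sU sW sK by blast+
  then have d: "vec.dim K \<le> vec.dim U + 2" "vec.dim W \<le> vec.dim K + 2"
    using UW(2) by linarith+
  have KU: "agree {a+2..b} s K U" and WK: "agree {a+2..b} s W K"
    using agree_of_dim_le_2[OF br' K(1) U' _ d(1)] agree_of_dim_le_2[OF br' W' K(1) _ d(2)] K b by auto
  have "agree {a+2..b} s W U"
    using b by (intro agree_extension[OF br' W' K(1) U' _ WK KU]) simp
  then have "eq_mod W U (s (a + 2)) (s (Suc (a + 2)))"
    using b unfolding agree_def by auto
  then show ?thesis
    using b by (intro agree_of_adjacent[OF br W U, of "a + 2"]) simp_all
qed

section \<open>A small subspace in the image of the first generator\<close>

lemma linear_image_span_subset: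
  assumes "lin f" "f ` B \<subseteq> vec.span B" shows "f ` vec.span B \<subseteq> vec.span B"
  using vec.span_minimal[OF assms(2) vec.subspace_span] by (simp add: vec.linear_span_image[OF assms(1)])

text \<open>
  The identities say that \<open>P\<close> is idempotent and that, with respect to the splitting
  \<open>im P \<oplus> ker P\<close>, \<open>X\<close> is a block matrix \<open>[[x, y], [z, 0]]\<close> with \<open>z (x + 2) = 0\<close>;
  \<open>Q\<close> is a polynomial in \<open>X\<close> and \<open>P\<close>.
\<close>

lemma small_common_invariant_subspace:
  fixes X P Q :: "complex^'r \<Rightarrow> complex^'r"
  assumes lin: "lin X" "lin P" "lin Q" and E: "vec.subspace E" "E \<noteq> {0}"
    and X: "\<And>v. v \<in> E \<Longrightarrow> X v \<in> E" and P: "\<And>v. v \<in> E \<Longrightarrow> P v \<in> E" and Q: "\<And>v. v \<in> E \<Longrightarrow> Q v \<in> E"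
    and PP: "\<And>v. v \<in> E \<Longrightarrow> P (v - P v) = 0"
    and XP: "\<And>v. v \<in> E \<Longrightarrow> X (v - P v) = P (v + X v + Q (P v))"
    and QP: "\<And>v. v \<in> E \<Longrightarrow> Q (v - P v) = X (v + X v + Q (P v))"
    and PE: "\<And>v. v \<in> E \<Longrightarrow> P v + X (P v) + Q (P (P v)) = 0"
    and QE: "\<And>v. v \<in> E \<Longrightarrow> Q v + X (Q v) + P (Q (Q v)) = 0"
  shows "\<exists>S. vec.subspace S \<and> S \<subseteq> E \<and> S \<noteq> {0} \<and> vec.dim S \<le> 2 \<and>
    X ` S \<subseteq> S \<and> P ` S \<subseteq> S \<and> Q ` S \<subseteq> S"
proof -
  note la = vec.linear_add[OF lin(1)] vec.linear_add[OF lin(2)] vec.linear_add[OF lin(3)]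
    vec.linear_diff[OF lin(1)] vec.linear_diff[OF lin(2)] vec.linear_diff[OF lin(3)]
    vec.linear_scale[OF lin(1)] vec.linear_scale[OF lin(2)] vec.linear_scale[OF lin(3)]
    vec.linear_neg[OF lin(1)] vec.linear_neg[OF lin(2)] vec.linear_neg[OF lin(3)]
    vec.linear_0[OF lin(1)] vec.linear_0[OF lin(2)] vec.linear_0[OF lin(3)]
  have Pi: "P (P v) = P v" if "v \<in> E" for v
    using PP[OF that] by (simp add: la)
  have QPv: "Q (P v) = - (P v + X (P v))" if "v \<in> E" for v
    using PE[OF that] Pi[OF that] by (metis add.commute eq_neg_iff_add_eq_0)
  \<comment> \<open>\<open>X\<close> sends \<open>v - P v\<close> into the fixed space of
    \<open>P\<close>: this is the zero block of \<open>X\<close>.\<close>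
  have PX: "P (X (v - P v)) = X (v - P v)" if "v \<in> E" for v
  proof -
    have "X v - X (P v) = P (X v) - P (X (P v))"
      using XP[OF that] QPv[OF that] Pi[OF that] by (simp add: la)
    from this[symmetric] show ?thesis by (simp add: la)
  qed
  have Qc: "Q (v - P v) = X (v - P v) + X (X (v - P v))" if "v \<in> E" for v
    using QP[OF that] QPv[OF that] by (simp add: la)
  \<comment> \<open>\<open>QPv\<close> and \<open>Qc\<close> express \<open>Q\<close> through
    \<open>X\<close> and \<open>P\<close> on both summands, so for a span it suffices to check
    \<open>X\<close> and \<open>P\<close> on the spanning vectors.\<close>
  have small: ?thesis
    if B: "finite B" "card B \<le> 2" "B \<subseteq> E" "v \<in> B" "v \<noteq> 0"
      and XB: "X ` B \<subseteq> vec.span B" and PB: "P ` B \<subseteq> vec.span B" for B v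
  proof (intro exI conjI)
    let ?S = "vec.span B"
    show S: "vec.subspace ?S" by (rule vec.subspace_span)
    show SE: "?S \<subseteq> E" using B(3) E(1) by (rule vec.span_minimal)
    show "?S \<noteq> {0}" using vec.span_base[OF B(4)] B(5) by auto
    show "vec.dim ?S \<le> 2"
      using vec.dim_le_card[of "?S" B] B(1,2) by simp
    show XS: "X ` ?S \<subseteq> ?S" and PS: "P ` ?S \<subseteq> ?S"
      using linear_image_span_subset lin XB PB by blast+
    have "Q v \<in> ?S" if v: "v \<in> ?S" for v
    proof -
      have vE: "v \<in> E" using v SE by blast
      have Pv: "P v \<in> ?S" and d: "v - P v \<in> ?S"
        using PS v vec.subspace_diff[OF S] by blast+
      have "Q (P v) \<in> ?S"
        unfolding QPv[OF vE] using XS Pv by (intro vec.subspace_neg[OF S] vec.subspace_add[OF S]) auto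
      moreover have "Q (v - P v) \<in> ?S"
        unfolding Qc[OF vE] using XS d by (intro vec.subspace_add[OF S]) auto
      ultimately have "Q (P v) + Q (v - P v) \<in> ?S"
        by (rule vec.subspace_add[OF S])
      then show ?thesis by (simp add: la)
    qed
    then show "Q ` ?S \<subseteq> ?S" by blast
  qed
  define E' where "E' = {v \<in> E. P v = v}"
  have sE': "vec.subspace E'"
    using E(1) unfolding E'_def vec.subspace_def by (simp add: la)
  \<comment> \<open>This is z (x + 2) = 0 in block form, for \<open>P\<close> fixes X (2 v + P X v).
    It comes from computing \<open>P (Q (Q v))\<close>, a vector fixed by \<open>P\<close>, through
    \<open>QE\<close>.\<close>
  have zx: "P (X v + X v + X (P (X v))) = X v + X v + X (P (X v))" if v: "v \<in> E'" for v
  proof -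
    have vE: "v \<in> E" and Pv: "P v = v" using v by (auto simp: E'_def)
    have Qv: "Q v = - (v + X v)" using QPv[OF vE] Pv by simp
    have "P (P (Q (Q v))) = P (Q (Q v))"
      using Pi[OF Q[OF Q[OF vE]]] .
    moreover have "P (Q (Q v)) = v + X v + X v + X (X v)"
    proof -
      have "P (Q (Q v)) = - (Q v + X (Q v))"
        using QE[OF vE] by (metis add.commute eq_neg_iff_add_eq_0)
      also have "\<dots> = v + X v + X v + X (X v)"
        unfolding Qv by (simp add: la)
      finally show ?thesis .
    qed
    ultimately have "P (X v + X v + X (X v)) = X v + X v + X (X v)"
      using Pv by (simp add: la)
    moreover have "P (X (X v - P (X v))) = X (X v - P (X v))"
      by (rule PX[OF X[OF vE]])
    ultimately have "P (X v + X v + X (X v)) - P (X (X v - P (X v))) =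
        X v + X v + X (X v) - X (X v - P (X v))"
      by simp
    then show ?thesis by (simp add: la)
  qed
  show ?thesis
  proof (cases "E' = {0}")
    case True
    \<comment> \<open>Here \<open>P\<close> vanishes on \<open>E\<close>, and \<open>XP\<close> then
      makes \<open>X\<close> vanish as well, so any line in \<open>E\<close> will do.\<close>
    have P0: "P v = 0" if "v \<in> E" for v
      using Pi[OF that] P[OF that] True unfolding E'_def by blast
    obtain v where v: "v \<in> E" "v \<noteq> 0"
      using E vec.subspace_0 by blast
    have "X v = 0" using XP[OF v(1)] P0 X[OF v(1)] Q v(1) vec.subspace_0[OF E(1)]
      by (simp add: la)
    then show ?thesis
      using v P0[OF v(1)] by (intro small[of "{v}" v]) (auto simp: vec.span_zero)
  next
    case False
    show ?thesis
    proof (cases "\<exists>v\<in>E'. v \<noteq> 0 \<and> P (X v) = X v")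
      case True
      \<comment> \<open>\<open>K\<close> is the kernel of z. By \<open>zx\<close> it is stable under
        \<open>X\<close>, and \<open>P\<close> is the identity on it, so an eigenvector of
        \<open>X\<close> spans an invariant line.\<close>
      define K where "K = {v \<in> E'. P (X v) = X v}"
      have sK: "vec.subspace K"
        using sE' unfolding K_def vec.subspace_def by (simp add: la)
      have "X ` K \<subseteq> K"
      proof
        fix u assume "u \<in> X ` K"
        then obtain v where v: "v \<in> E'" "P (X v) = X v" "u = X v"
          by (auto simp: K_def)
        have "P (X v) + P (X v) + P (X (X v)) = X v + X v + X (X v)"
          using zx[OF v(1)] by (simp only: la v(2))
        then have "P (X (X v)) = X (X v)"
          by (simp only: v(2) add_left_cancel)
        then show "u \<in> K"
          using v X[of v] by (simp add: K_def E'_def)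
      qed
      moreover obtain v where "v \<in> K" "v \<notin> {0}"
        using True unfolding K_def by blast
      ultimately obtain l w where "w \<in> K" "w \<notin> {0}" "X w - l *s w \<in> {0}"
        using eigenvector_mod_exists[OF lin(1) vec.subspace_single_0 sK] by blast
      then have w: "w \<in> K" "w \<noteq> 0" "X w = l *s w" by simp_all
      then show ?thesis
        by (intro small[of "{w}" w]) (auto simp: K_def E'_def intro: vec.span_scale vec.span_base)
    next
      case False
      \<comment> \<open>Now z is injective on \<open>E'\<close>, so z (x + 2) = 0 forces x =
        -2.\<close>
      have x: "P (X v) = - (v + v)" if v: "v \<in> E'" for v
      proof -
        have vE: "v \<in> E" and Pv: "P v = v" using v by (auto simp: E'_def)
        have "P (X v) + v + v \<in> E'"
          using v P[OF X[OF vE]] Pi[OF X[OF vE]]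
          by (intro vec.subspace_add[OF sE']) (auto simp: E'_def)
        moreover have "P (X (P (X v) + v + v)) = X (P (X v) + v + v)"
          using zx[OF v] by (simp only: la add_ac)
        ultimately have "P (X v) + v + v = 0" using False by blast
        then show ?thesis by (simp add: eq_neg_iff_add_eq_0 add.assoc)
      qed
      \<comment> \<open>\<open>?Y\<close> is the product y z of the off-diagonal blocks. For an
        eigenvector w of it, \<open>X\<close> sends w to z w - 2 w and z w to a multiple of w, so
        these two vectors span an invariant subspace.\<close>
      let ?Y = "\<lambda>v. X (X v - P (X v))"
      have "lin ?Y"
        using lin by (simp add: Vector_Spaces.linear_iff la algebra_simps vec.scale_right_diff_distrib)
      moreover have "?Y ` E' \<subseteq> E'"
      proof
        fix u assume "u \<in> ?Y ` E'"
        then obtain v where v: "v \<in> E'" "u = ?Y v" by blast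
        then have "X v \<in> E" using X by (simp add: E'_def)
        then show "u \<in> E'"
          using PX[of "X v"] X[of "X v - P (X v)"] P vec.subspace_diff[OF E(1)] v(2)
          by (simp add: E'_def)
      qed
      moreover obtain v where "v \<in> E'" "v \<notin> {0}"
        using \<open>E' \<noteq> {0}\<close> vec.subspace_0[OF sE'] by blast
      ultimately obtain l w where "w \<in> E'" "w \<notin> {0}" "?Y w - l *s w \<in> {0}"
        using eigenvector_mod_exists[OF _ vec.subspace_single_0 sE', of ?Y] by blast
      then have w: "w \<in> E'" "w \<noteq> 0" "?Y w = l *s w" by simp_all
      let ?z = "X w - P (X w)"
      have wE: "w \<in> E" and Pw: "P w = w" using w(1) by (auto simp: E'_def)
      have "X w = ?z + (- (w + w))" using x[OF w(1)] by simp
      then have 1: "X w \<in> vec.span {w, ?z}"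
        by (metis insertI1 insertI2 vec.span_add vec.span_base vec.span_neg)
      have 2: "X ?z \<in> vec.span {w, ?z}"
        unfolding w(3) by (intro vec.span_scale vec.span_base) simp
      have 3: "P ?z = 0" using Pi[OF X[OF wE]] by (simp add: la)
      have 4: "P w \<in> vec.span {w, ?z}" unfolding Pw by (intro vec.span_base) simp
      have zE: "?z \<in> E" using X[OF wE] P vec.subspace_diff[OF E(1)] by blast
      have "card {w, ?z} \<le> 2" by (simp add: card_insert_if)
      then show ?thesis
        by (rule small[of "{w, ?z}" w, rotated])
          (use w 1 2 3 4 wE zE in \<open>auto simp: vec.span_zero\<close>)
    qed
  qed
qed

declare One_nat_def [simp del]

section \<open>Irreducible braided families\<close>

text \<open>Irreducibility is tested on the generators alone;
  \<open>invariant_of_stable_under\<close> links this to invariance under the whole group.\<close>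

locale irreducible_braided =
  fixes s :: "nat \<Rightarrow> complex^'r \<Rightarrow> complex^'r" and m :: nat
  assumes br: "braided {1..m} s"
    and irr: "\<And>W. stable_under {1..m} s W \<Longrightarrow> W = {0} \<or> W = UNIV"
begin

definition A :: "nat \<Rightarrow> complex^'r \<Rightarrow> complex^'r" where
  "A i v = s i v - v"

lemma s_eq: "s i v = v + A i v"
  by (simp add: A_def)

lemma lin_s: "i \<in> {1..m} \<Longrightarrow> lin (s i)"
  using braided_lin[OF br] .

lemma lin_A: "i \<in> {1..m} \<Longrightarrow> lin (A i)"
  unfolding A_def[abs_def] by (intro vec.linear_compose_sub lin_s vec.linear_ident)

lemma s_commute: "i \<in> {1..m} \<Longrightarrow> j \<in> {1..m} \<Longrightarrow> i + 2 \<le> j \<or> j + 2 \<le> i \<Longrightarrow> s i (s j v) = s j (s i v)"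
  using braided_commute[OF br] .

lemma A_s_commute:
  "i \<in> {1..m} \<Longrightarrow> j \<in> {1..m} \<Longrightarrow> i = j \<or> i + 2 \<le> j \<or> j + 2 \<le> i \<Longrightarrow> A i (s j v) = s j (A i v)"
  unfolding A_def using s_commute[of i j v] by (auto simp: vec.linear_diff[OF lin_s])

lemma A_commute:
  assumes "i \<in> {1..m}" "j \<in> {1..m}" "i + 2 \<le> j \<or> j + 2 \<le> i"
  shows "A i (A j v) = A j (A i v)"
  using A_s_commute[OF assms(1,2) disjI2[OF assms(3)], of v]
  by (simp only: s_eq vec.linear_add[OF lin_A[OF assms(1)]] add_left_cancel)

lemma range_A_stable:
  assumes "i \<in> {1..m}" "J \<subseteq> {1..m}" "\<And>j. j \<in> J \<Longrightarrow> i + 2 \<le> j \<or> j + 2 \<le> i"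
  shows "stable_under J s (range (A i))"
  unfolding stable_under_def
proof (intro conjI ballI)
  show "vec.subspace (range (A i))"
    using vec.linear_subspace_image[OF lin_A[OF assms(1)] vec.subspace_UNIV] .
  fix j u assume j: "j \<in> J" and "u \<in> range (A i)"
  then obtain v where "u = A i v" by blast
  then have "s j u = A i (s j v)"
    using A_s_commute[OF assms(1), of j v] assms(2) assms(3)[OF j] j by auto
  then show "s j u \<in> range (A i)" by blast
qed

section \<open>The product of all generators, which shifts each generator to the next\<close>

primrec T :: "nat \<Rightarrow> complex^'r \<Rightarrow> complex^'r" where
  "T 0 v = v"
| "T (Suc k) v = T k (s (Suc k) v)"

lemma T_lin_bij: "k \<le> m \<Longrightarrow> lin (T k) \<and> bij (T k)"
proof (induction k)
  case 0
  have "T 0 = id" by auto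
  show ?case unfolding \<open>T 0 = id\<close> by (simp only: vec.linear_id bij_id simp_thms)
next
  case (Suc k)
  have eq: "T (Suc k) = T k \<circ> s (Suc k)" by auto
  have "lin (T k)" "bij (T k)" "lin (s (Suc k))" "bij (s (Suc k))"
    using Suc braided_bij[OF br, of "Suc k"] lin_s[of "Suc k"] by auto
  then show ?case
    unfolding eq by (intro conjI bij_comp Vector_Spaces.linear_compose)
qed

lemma T_s_commute: "k + 2 \<le> j \<Longrightarrow> j \<le> m \<Longrightarrow> T k (s j v) = s j (T k v)"
proof (induction k arbitrary: v)
  case (Suc k)
  have "s (Suc k) (s j v) = s j (s (Suc k) v)"
    using Suc.prems by (intro s_commute) auto
  then show ?case using Suc by simp
qed simp

text \<open>The generator \<open>s i\<close> passes the factors beyond \<open>Suc i\<close>, the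
  braid relation turns it into \<open>s (Suc i)\<close>, and this passes the factors before
  \<open>i\<close>.\<close>

lemma T_shift: "1 \<le> i \<Longrightarrow> i < k \<Longrightarrow> k \<le> m \<Longrightarrow> T k (s i v) = s (Suc i) (T k v)"
proof (induction k arbitrary: v)
  case (Suc k)
  show ?case
  proof (cases "i = k")
    case True
    then obtain k' where k': "k = Suc k'"
      using Suc.prems by (metis Suc_le_D One_nat_def)
    have "T (Suc k) (s i v) = T k' (s k (s (Suc k) (s k v)))"
      using True k' by simp
    also have "\<dots> = T k' (s (Suc k) (s k (s (Suc k) v)))"
      using Suc.prems True by (subst braided_braid[OF br]) auto
    also have "\<dots> = s (Suc k) (T k' (s k (s (Suc k) v)))"
      using Suc.prems k' by (intro T_s_commute) auto
    finally show ?thesis using True k' by simp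
  next
    case False
    have "s (Suc k) (s i v) = s i (s (Suc k) v)"
      using Suc.prems False by (intro s_commute) auto
    then show ?thesis using Suc False by simp
  qed
qed simp

definition \<tau> :: "complex^'r \<Rightarrow> complex^'r" where "\<tau> = T m"

lemma lin_tau: "lin \<tau>" and bij_tau: "bij \<tau>"
  using T_lin_bij[of m] by (simp_all add: \<tau>_def)

lemma tau_A: "1 \<le> i \<Longrightarrow> i < m \<Longrightarrow> \<tau> (A i v) = A (Suc i) (\<tau> v)"
  using T_shift[of i m v] vec.linear_diff[OF lin_tau] by (simp add: A_def \<tau>_def)

lemma lin_tau_pow: "lin (\<tau> ^^ k)" and bij_tau_pow: "bij (\<tau> ^^ k)"
  using lin_funpow[OF lin_tau] bij_betw_funpow[OF bij_tau] by blast+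

lemma tau_pow_A: "1 \<le> i \<Longrightarrow> i + k \<le> m \<Longrightarrow> (\<tau> ^^ k) (A i v) = A (i + k) ((\<tau> ^^ k) v)"
proof (induction k)
  case (Suc k)
  then show ?case using tau_A[of "i + k" "(\<tau> ^^ k) v"] by simp
qed simp

end

section \<open>Families in which products of non-adjacent operators \<open>A i\<close>
  vanish\<close>

locale irreducible_braided_orthogonal = irreducible_braided s m
  for s :: "nat \<Rightarrow> complex^'r \<Rightarrow> complex^'r" and m +
  assumes m3: "3 \<le> m"
    and AA: "\<And>i j v. i \<in> {1..m} \<Longrightarrow> j \<in> {1..m} \<Longrightarrow> i + 2 \<le> j \<or> j + 2 \<le> i \<Longrightarrow> A i (A j v) = 0"
begin

abbreviation E where "E \<equiv> range (A 1)"
abbreviation X where "X \<equiv> A 1"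
text \<open>With \<open>X\<close>, these encode every generator on the translates of
  \<open>E\<close> by powers of \<tau>: on the i-th translate, \<open>A i\<close>,
  \<open>A (i + 1)\<close> and \<open>A (i + 2)\<close> act through \<open>Q\<close>,
  \<open>X\<close> and \<open>P\<close>, as \<open>A_tau_pow_E\<close> shows.\<close>

definition P :: "complex^'r \<Rightarrow> complex^'r" where "P v = A 1 (inv_into UNIV \<tau> v)"
definition Q :: "complex^'r \<Rightarrow> complex^'r" where "Q v = A 1 (\<tau> v)"

lemma lin_A1: "lin (A 1)" and lin_A2: "lin (A 2)" and lin_A3: "lin (A 3)"
  using lin_A m3 by auto

lemma lin_Q: "lin Q"
proof -
  have "Q = A 1 \<circ> \<tau>" by (auto simp: Q_def)
  then show ?thesis using Vector_Spaces.linear_compose[OF lin_tau lin_A1] by simp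
qed

lemma lin_inv_tau: "lin (inv_into UNIV \<tau>)"
  by (rule vec.inj_linear_imp_inv_linear[OF lin_tau bij_is_inj[OF bij_tau]])

lemma lin_P: "lin P"
proof -
  have "P = A 1 \<circ> inv_into UNIV \<tau>" by (auto simp: P_def)
  then show ?thesis using Vector_Spaces.linear_compose[OF lin_inv_tau lin_A1] by simp
qed

lemma tau_P: "\<tau> (P v) = A 2 v"
  using tau_A[of 1 "inv_into UNIV \<tau> v"] m3 surj_f_inv_f[OF bij_is_surj[OF bij_tau], of v]
  by (simp add: P_def)

lemma tau_A1: "A 2 (\<tau> v) = \<tau> (X v)" and tau_A2: "A 3 (\<tau> v) = \<tau> (A 2 v)"
  using tau_A[of 1 v] tau_A[of 2 v] m3 by simp_all

lemma in_E: "X v \<in> E" "P v \<in> E" "Q v \<in> E"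
  by (simp_all add: P_def Q_def)

lemma A_on_E: "v \<in> E \<Longrightarrow> 3 \<le> j \<Longrightarrow> j \<le> m \<Longrightarrow> A j v = 0"
  using AA[of j 1] m3 by auto

text \<open>Only the first two factors of \<tau> act nontrivially on \<open>E\<close>. Expanding
  \<open>s 1 (s 2 v)\<close> and using \<open>tau_P\<close> gives the formula.\<close>

lemma tau_on_E: assumes v: "v \<in> E" shows "\<tau> v = v + X v + Q (P v) + \<tau> (P v)"
proof -
  have "T k v = T 2 v" if "2 \<le> k" "k \<le> m" for k
    using that
  proof (induction k rule: dec_induct)
    case (step k)
    have "s (Suc k) v = v"
      using A_on_E[OF v, of "Suc k"] step by (simp add: s_eq)
    then show ?case using step by simp
  qed simp
  then have "\<tau> v = s 1 (s 2 v)"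
    using m3 by (simp add: \<tau>_def numeral_2_eq_2 One_nat_def)
  also have "\<dots> = v + A 2 v + (A 1 v + A 1 (A 2 v))"
    by (simp add: s_eq vec.linear_add[OF lin_A1])
  also have "A 1 (A 2 v) = Q (P v)"
    by (simp add: Q_def tau_P)
  finally show ?thesis
    by (simp add: tau_P)
qed

lemmas tau_simps = vec.linear_add[OF lin_tau] vec.linear_diff[OF lin_tau] vec.linear_0[OF lin_tau]

lemma tau_inject: "\<tau> u = \<tau> v \<longleftrightarrow> u = v"
  by (rule inj_eq[OF bij_is_inj[OF bij_tau]])

text \<open>The right side lies in \<open>E\<close>, so \<tau> carries \<open>v - P v\<close> back
  into \<open>E\<close>. Applying \<open>A 3\<close>, \<open>A 2\<close> and \<open>A 1\<close> to
  this equation yields the next three identities for \<open>P\<close>, \<open>X\<close> and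
  \<open>Q\<close>.\<close>

lemma tau_complement:
  "v \<in> E \<Longrightarrow> \<tau> (v - P v) = v + X v + Q (P v)"
  using tau_on_E[of v] by (simp add: tau_simps)

lemma subspace_E: "vec.subspace E"
  using vec.linear_subspace_image[OF lin_A1 vec.subspace_UNIV] .

lemma P_idem: assumes v: "v \<in> E" shows "P (v - P v) = 0"
proof -
  have "v + X v + Q (P v) \<in> E"
    using v in_E by (intro vec.subspace_add[OF subspace_E])
  then have "A 3 (\<tau> (v - P v)) = 0"
    unfolding tau_complement[OF v] using m3 by (intro A_on_E) auto
  then have "\<tau> (\<tau> (P (v - P v))) = \<tau> (\<tau> 0)"
    by (simp add: tau_A2 tau_P vec.linear_0[OF lin_tau])
  then show ?thesis by (simp only: tau_inject)
qed

lemma X_complement: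
  assumes v: "v \<in> E" shows "X (v - P v) = P (v + X v + Q (P v))"
proof -
  have "\<tau> (X (v - P v)) = \<tau> (P (v + X v + Q (P v)))"
    unfolding tau_A1[symmetric] tau_complement[OF v] tau_P ..
  then show ?thesis by (simp only: tau_inject)
qed

lemma Q_complement: "v \<in> E \<Longrightarrow> Q (v - P v) = X (v + X v + Q (P v))"
  by (simp add: Q_def tau_complement)

text \<open>Since \<open>s 3\<close> fixes \<open>E\<close>, the braid relation between
  \<open>s 2\<close> and \<open>s 3\<close> reduces on \<open>E\<close> to the vanishing of
  \<open>A 2 (s 3 (s 2 v))\<close>; expand and pull out \<tau>.\<close>

lemma braid_P: assumes v: "v \<in> E" shows "P v + X (P v) + Q (P (P v)) = 0"
proof -
  have A3: "A 3 v = 0" and s3: "s 3 v = v"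
    using A_on_E[OF v, of 3] m3 by (simp_all add: s_eq)
  have "s 2 (s 3 (s 2 v)) = s 3 (s 2 v)"
    using braided_braid[OF br, of 2 v] m3 s3 by simp
  then have "A 2 (s 3 (s 2 v)) = 0"
    by (simp add: A_def)
  moreover have "A 2 (s 3 (s 2 v)) = A 2 v + A 2 (A 2 v) + A 2 (A 3 (A 2 v))"
    by (simp only: s_eq vec.linear_add[OF lin_A3] vec.linear_add[OF lin_A2] A3 add_0_left)
  moreover have "A 2 (A 2 v) = \<tau> (X (P v))"
    by (simp only: tau_P[of v, symmetric] tau_A1)
  moreover have "A 2 (A 3 (A 2 v)) = \<tau> (Q (P (P v)))"
    by (simp only: tau_P[of v, symmetric] tau_A2 Q_def tau_P[of "P v", symmetric] tau_A1)
  ultimately have "\<tau> (P v + X (P v) + Q (P (P v))) = \<tau> 0"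
    by (simp only: tau_simps tau_P)
  then show ?thesis by (simp only: tau_inject)
qed

text \<open>The mirror image of \<open>braid_P\<close>: two shifts move \<open>v\<close> into the
  image of \<open>A 3\<close>, which \<open>s 1\<close> fixes, and the relation between
  \<open>s 1\<close> and \<open>s 2\<close> is read off there.\<close>

lemma braid_Q: assumes v: "v \<in> E" shows "Q v + X (Q v) + P (Q (Q v)) = 0"
proof -
  let ?w = "\<tau> (\<tau> v)"
  obtain u where u: "v = A 1 u" using v by blast
  have w: "?w = A 3 (\<tau> (\<tau> u))"
    by (simp add: u tau_A1[symmetric] tau_A2[symmetric])
  have A1: "A 1 ?w = 0" and s1: "s 1 ?w = ?w"
    unfolding w using AA[of 1 3] m3 by (simp_all add: s_eq)
  have "s 2 (s 1 (s 2 ?w)) = s 1 (s 2 ?w)"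
    using braided_braid[OF br, of 1 ?w] m3 s1 by simp
  then have "A 2 (s 1 (s 2 ?w)) = 0"
    by (simp add: A_def)
  moreover have "A 2 (s 1 (s 2 ?w)) = A 2 ?w + A 2 (A 2 ?w) + A 2 (A 1 (A 2 ?w))"
    by (simp only: s_eq vec.linear_add[OF lin_A1] vec.linear_add[OF lin_A2] A1 add_0_left)
  moreover have 2: "A 2 ?w = \<tau> (Q v)"
    by (simp only: tau_A1 Q_def)
  moreover have "A 2 (A 2 ?w) = \<tau> (X (Q v))"
    unfolding 2 by (rule tau_A1)
  moreover have "A 2 (A 1 (A 2 ?w)) = \<tau> (P (Q (Q v)))"
    unfolding 2 by (simp only: tau_P Q_def)
  ultimately have "\<tau> (Q v + X (Q v) + P (Q (Q v))) = \<tau> 0"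
    by (simp only: tau_simps)
  then show ?thesis by (simp only: tau_inject)
qed

text \<open>The i-th translate of \<open>E\<close> lies in the image of \<open>A (i + 1)\<close>, so
  orthogonality kills every \<open>A j\<close> except those with j between i and i + 2; for these,
  move \<open>A j\<close> through the power of \<tau>.\<close>

lemma A_tau_pow_E:
  assumes y: "y \<in> E" and i: "i < m" and j: "j \<in> {1..m}"
  shows "A j ((\<tau> ^^ i) y) =
    (if j = i then (\<tau> ^^ (j - 1)) (Q y) else if j = i + 1 then (\<tau> ^^ i) (X y)
     else if j = i + 2 then (\<tau> ^^ (i + 1)) (P y) else 0)"
proof -
  consider "j = i" | "j = i + 1" | "j = i + 2" | "i + 3 \<le> j" | "j < i" by linarith
  then show ?thesis
  proof cases
    case 1
    obtain k where k: "i = Suc k" using 1 j by (cases i) auto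
    show ?thesis
      using tau_pow_A[of 1 k "\<tau> y"] 1 k j by (simp add: Q_def funpow_swap1 plus_1_eq_Suc)
  next
    case 2
    have "A (1 + i) ((\<tau> ^^ i) y) = (\<tau> ^^ i) (X y)"
      using 2 j by (intro tau_pow_A[symmetric]) auto
    then show ?thesis using 2 by (simp add: add.commute)
  next
    case 3
    have "A (2 + i) ((\<tau> ^^ i) y) = (\<tau> ^^ i) (A 2 y)"
      using 3 j by (intro tau_pow_A[symmetric]) auto
    also have "\<dots> = (\<tau> ^^ (i + 1)) (P y)"
      by (simp only: tau_P[symmetric] Suc_eq_plus1[symmetric] funpow_Suc_right o_apply)
    finally show ?thesis using 3 by (simp add: add.commute)
  next
    case 4
    have "A j ((\<tau> ^^ i) y) = (\<tau> ^^ i) (A (j - i) y)"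
      using tau_pow_A[of "j - i" i y] 4 j by auto
    also have "A (j - i) y = 0"
      using A_on_E[OF y, of "j - i"] 4 j by auto
    finally show ?thesis using 4 vec.linear_0[OF lin_tau_pow] by simp
  next
    case 5
    obtain u where u: "y = A 1 u" using y by blast
    have "A j ((\<tau> ^^ i) y) = A j (A (Suc i) ((\<tau> ^^ i) u))"
      using tau_pow_A[of 1 i u] i u by (simp add: plus_1_eq_Suc)
    also have "\<dots> = 0"
      using AA[of j "Suc i"] 5 i j by auto
    finally show ?thesis using 5 by simp
  qed
qed

text \<open>The translates of \<open>S\<close> span a stable nonzero subspace, hence everything.
  \<open>A 1\<close> sends the translates with exponents 0 and 1 into \<open>S\<close> through
  \<open>X\<close> and \<open>Q\<close> and kills the others, so \<open>E\<close> is contained in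
  \<open>S\<close>.\<close>

lemma dim_E_le_2: "vec.dim E \<le> 2"
proof (cases "E = {0}")
  case True
  then show ?thesis by simp
next
  case False
  obtain S where S: "vec.subspace S" "S \<subseteq> E" "S \<noteq> {0}" "vec.dim S \<le> 2"
      "X ` S \<subseteq> S" "P ` S \<subseteq> S" "Q ` S \<subseteq> S"
    using small_common_invariant_subspace[of X P Q E, OF lin_A1 lin_P lin_Q subspace_E False in_E
        P_idem X_complement Q_complement braid_P braid_Q]
    by blast
  \<comment> \<open>Exponents below \<open>m\<close> suffice: exponent \<open>i + 1\<close> arises
    only from \<open>j = i + 2\<close>, which is at most \<open>m\<close>.\<close>
  define G where "G = (\<Union>i<m. (\<tau> ^^ i) ` S)"
  have G: "(\<tau> ^^ i) y \<in> G" if "i < m" "y \<in> S" for i y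
    using that unfolding G_def by blast
  have AG: "A j ` G \<subseteq> vec.span G" if j: "j \<in> {1..m}" for j
  proof
    fix x assume "x \<in> A j ` G"
    then obtain i y where i: "i < m" and y: "y \<in> S" and x: "x = A j ((\<tau> ^^ i) y)"
      by (auto simp: G_def)
    have yE: "y \<in> E" and XPQ: "X y \<in> S" "P y \<in> S" "Q y \<in> S"
      using y S by blast+
    show "x \<in> vec.span G"
      unfolding x A_tau_pow_E[OF yE i j] using G XPQ i j
      by (auto intro!: vec.span_base simp: vec.span_zero simp del: funpow.simps)
  qed
  have "stable_under {1..m} s (vec.span G)"
    unfolding stable_under_def
  proof (intro conjI ballI)
    fix j v assume j: "j \<in> {1..m}" and v: "v \<in> vec.span G"
    then have "A j v \<in> vec.span G"
      using linear_image_span_subset[OF lin_A[OF j] AG[OF j]] by blast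
    then have "v + A j v \<in> vec.span G"
      by (rule vec.span_add[OF v])
    then show "s j v \<in> vec.span G"
      by (simp only: s_eq)
  qed (rule vec.subspace_span)
  then have "vec.span G = {0} \<or> vec.span G = UNIV"
    by (rule irr)
  moreover have "S \<subseteq> vec.span G"
    using G[of 0] m3 by (auto intro: vec.span_base)
  ultimately have "vec.span G = UNIV"
    using S(1,3) vec.subspace_0 by blast
  then have "E = vec.span (A 1 ` G)"
    using vec.linear_span_image[OF lin_A1, of G] by simp
  also have "\<dots> \<subseteq> S"
  proof (rule vec.span_minimal[OF _ S(1)], rule subsetI)
    fix x assume "x \<in> A 1 ` G"
    then obtain i y where i: "i < m" and y: "y \<in> S" and x: "x = A 1 ((\<tau> ^^ i) y)"
      by (auto simp: G_def)
    have yE: "y \<in> E" and XPQ: "X y \<in> S" "P y \<in> S" "Q y \<in> S"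
      using y S by blast+
    show "x \<in> S"
      using A_tau_pow_E[OF yE i, of 1] XPQ m3 vec.subspace_0[OF S(1)] unfolding x
      by (auto split: if_splits)
  qed
  finally have "vec.dim E \<le> vec.dim S"
    by (rule vec.dim_subset)
  then show ?thesis using S(4) by linarith
qed

end

section \<open>Vanishing of products of non-adjacent operators\<close>

context irreducible_braided
begin

lemma dim_range_A:
  assumes "i \<in> {1..m}"
  shows "vec.dim (range (A i)) = vec.dim (range (A 1))"
proof -
  let ?f = "\<tau> ^^ (i - 1)"
  have "?f (A 1 v) = A i (?f v)" for v
    using tau_pow_A[of 1 "i - 1" v] assms by simp
  then have "?f ` range (A 1) = A i ` range ?f"
    by (simp add: image_image)
  also have "range ?f = UNIV"
    by (rule bij_is_surj[OF bij_tau_pow])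
  finally have "range (A i) = ?f ` range (A 1)" ..
  then show ?thesis
    by (simp only: vec.dim_image_eq[OF lin_tau_pow inj_on_subset[OF bij_is_inj[OF bij_tau_pow] subset_UNIV]])
qed

lemma stable_zero: "J \<subseteq> {1..m} \<Longrightarrow> stable_under J s {0}"
  unfolding stable_under_def using vec.linear_0[OF lin_s] by auto

text \<open>The generators in \<open>{a..b}\<close> preserve the image of \<open>A i\<close>, whose
  dimension is at most three, so \<open>agree_of_dim_le_3\<close> applies with \<open>U\<close>
  zero.\<close>

lemma A_range_agree:
  assumes i: "i \<in> {1..m}" and J: "{a..b} \<subseteq> {1..m}" "\<And>j. j \<in> {a..b} \<Longrightarrow> i + 2 \<le> j \<or> j + 2 \<le> i"
    and ab: "a + 6 \<le> b" and d: "vec.dim (range (A 1)) \<le> 3" and jk: "j \<in> {a..b}" "k \<in> {a..b}"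
  shows "A j (A i v) = A k (A i v)"
proof -
  have "agree {a..b} s (range (A i)) {0}"
    using ab d dim_range_A[OF i] vec.linear_0[OF lin_A[OF i]]
    by (intro agree_of_dim_le_3[OF braided_subset[OF br J(1)] range_A_stable[OF i J]
        stable_zero[OF J(1)]]) (auto intro: range_eqI)
  from agreeD[OF this jk, of "A i v"] show ?thesis
    by (simp add: A_def)
qed

lemma dim_1_of_agree:
  assumes m: "1 \<le> m" and ag: "agree {1..m} s UNIV {0}"
  shows "vec.dim (UNIV :: (complex^'r) set) \<le> 1"
proof -
  have eq: "s i v = s 1 v" if "i \<in> {1..m}" for i v
    using agreeD[OF ag that, of 1 v] m by simp
  have "axis undefined 1 \<notin> {0 :: complex^'r}"
    by (simp add: axis_eq_0_iff)
  moreover have "lin (s 1)" using lin_s m by simp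
  ultimately obtain l v where v: "v \<notin> {0}" "s 1 v - l *s v \<in> {0}"
    using eigenvector_mod_exists[OF _ vec.subspace_single_0 vec.subspace_UNIV, of "s 1"] by blast
  have "stable_under {1..m} s (vec.span {v})"
    unfolding stable_under_def
  proof (intro conjI ballI)
    fix i u assume i: "i \<in> {1..m}" and u: "u \<in> vec.span {v}"
    have "s 1 ` {v} \<subseteq> vec.span {v}"
      using v(2) by (auto intro: vec.span_scale vec.span_base)
    then show "s i u \<in> vec.span {v}"
      unfolding eq[OF i] using linear_image_span_subset[OF lin_s[of 1]] m u by auto
  qed (rule vec.subspace_span)
  then have "vec.span {v} = UNIV"
    using irr v(1) vec.span_base[of v "{v}"] by blast
  then show ?thesis
    using vec.dim_le_card[of "UNIV :: (complex^'r) set" "{v}"] by simp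
qed

text \<open>
  By \<open>A_range_agree\<close> the operator \<open>A 1 \<circ> A m\<close> has so many expressions \<open>A i \<circ> A j\<close> that
  for every generator there is one whose factors both commute with it.
\<close>

lemma A_1_A_m_zero:
  assumes m: "9 \<le> m" and d: "vec.dim (range (A 1)) \<le> 3" "1 < vec.dim (range (A 1))"
  shows "A 1 (A m v) = 0"
proof -
  \<comment> \<open>The bound \<open>9 \<le> m\<close> leaves at least seven generators in each of
    \<open>{3..m}\<close> and \<open>{1..m - 2}\<close>.\<close>
  have one: "A j (A 1 v) = A m (A 1 v)" if "3 \<le> j" "j \<le> m" for j v
    using m d that by (intro A_range_agree[where a = 3 and b = m]) auto
  have last: "A j (A m v) = A 1 (A m v)" if "1 \<le> j" "j + 2 \<le> m" for j v
    using m d that by (intro A_range_agree[where a = 1 and b = "m - 2"]) auto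
  define M where "M v = A 1 (A m v)" for v
  have M1: "M v = A j (A 1 v)" if "3 \<le> j" "j \<le> m" for j v
    using one[OF that] A_commute[of 1 m v] m by (simp add: M_def)
  have Mm: "M v = A j (A m v)" if "1 \<le> j" "j + 2 \<le> m" for j v
    using last[OF that] by (simp add: M_def)
  have MM: "M (s k v) = s k (M v)" if k: "k \<in> {1..m}" for k v
  proof -
    \<comment> \<open>Only 2 and m - 1 are adjacent to 1 or m, so only they need another expression
      for \<open>M\<close>: 5 and m are far from 2, while 3 and 1 are far from m - 1.\<close>
    consider "k = 2" | "k + 1 = m" | "k \<noteq> 2" "k + 1 \<noteq> m" by blast
    then show ?thesis
    proof cases
      case 1
      have "A 5 (A m (s k v)) = s k (A 5 (A m v))"
        using 1 m by (simp add: A_s_commute)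
      then show ?thesis using Mm[of 5] m by simp
    next
      case 2
      have "A 3 (A 1 (s k v)) = s k (A 3 (A 1 v))"
        using 2 m by (simp add: A_s_commute)
      then show ?thesis using M1[of 3] m by simp
    next
      case 3
      have "k = 1 \<or> 3 \<le> k" "k = m \<or> k + 2 \<le> m"
        using 3 k by auto
      then show ?thesis
        unfolding M_def using k m by (subst A_s_commute, simp, simp, linarith, subst A_s_commute) auto
    qed
  qed
  have lM: "lin M"
  proof -
    have "M = A 1 \<circ> A m" by (auto simp: M_def)
    then show ?thesis
      using Vector_Spaces.linear_compose[OF lin_A lin_A] m by simp
  qed
  have "stable_under {1..m} s (range M)"
    unfolding stable_under_def
  proof (intro conjI ballI)
    fix k u assume k: "k \<in> {1..m}" and "u \<in> range M"
    then obtain v where "u = M v" by blast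
    then have "s k u = M (s k v)" using MM[OF k] by simp
    then show "s k u \<in> range M" by blast
  qed (rule vec.linear_subspace_image[OF lM vec.subspace_UNIV])
  then consider "range M = {0}" | "range M = UNIV" using irr by blast
  then show ?thesis
  proof cases
    case 1
    then show ?thesis unfolding M_def by blast
  next
    case 2
    \<comment> \<open>If \<open>M\<close> is onto, so is \<open>A 1\<close>. The whole space then
      has dimension at most three, all generators coincide, and irreducibility leaves dimension one,
      against \<open>d(2)\<close>.\<close>
    then have U: "range (A 1) = UNIV" unfolding M_def by blast
    have "stable_under {1..m} s UNIV" unfolding stable_under_def by simp
    then have "agree {1..m} s UNIV {0}"
      using m d(1) U by (intro agree_of_dim_le_3[OF br _ stable_zero]) simp_all
    then have "vec.dim (UNIV :: (complex^'r) set) \<le> 1"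
      using m by (intro dim_1_of_agree) simp_all
    then show ?thesis using d(2) U by simp
  qed
qed

text \<open>Conjugation by a power of \<tau> reduces to i = 1, where \<open>A_range_agree\<close>
  allows the second index to be replaced by \<open>m\<close>.\<close>

lemma A_orthogonal:
  assumes m: "9 \<le> m" and d: "vec.dim (range (A 1)) \<le> 3" "1 < vec.dim (range (A 1))"
    and ij: "1 \<le> i" "i + 2 \<le> j" "j \<le> m"
  shows "A i (A j v) = 0"
proof -
  let ?f = "\<tau> ^^ (i - 1)"
  obtain u where u: "v = ?f u"
    using bij_is_surj[OF bij_tau_pow] by (metis surjD)
  have k: "3 \<le> j - (i - 1)" "j - (i - 1) \<le> m" using ij by auto
  have f: "A j (?f w) = ?f (A (j - (i - 1)) w)" "A i (?f w) = ?f (A 1 w)" for w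
    using tau_pow_A[of "j - (i - 1)" "i - 1" w] tau_pow_A[of 1 "i - 1" w] ij by simp_all
  have "A 1 (A (j - (i - 1)) u) = A (j - (i - 1)) (A 1 u)"
    using k by (intro A_commute) auto
  also have "\<dots> = A m (A 1 u)"
    using m d k by (intro A_range_agree[where a = 3 and b = m]) auto
  also have "\<dots> = A 1 (A m u)"
    using m by (intro A_commute) auto
  also have "\<dots> = 0"
    by (rule A_1_A_m_zero[OF m d])
  finally show ?thesis
    unfolding u f using vec.linear_0[OF lin_tau_pow] by simp
qed

lemma dim_range_A_ne_3:
  assumes m: "9 \<le> m" and i: "i \<in> {1..m}"
  shows "vec.dim (range (A i)) \<noteq> 3"
proof
  assume "vec.dim (range (A i)) = 3"
  then have d: "vec.dim (range (A 1)) \<le> 3" "1 < vec.dim (range (A 1))"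
    and d3: "vec.dim (range (A 1)) = 3"
    using dim_range_A[OF i] by simp_all
  have AA: "A i (A j v) = 0"
    if "i \<in> {1..m}" "j \<in> {1..m}" "i + 2 \<le> j \<or> j + 2 \<le> i" for i j v
    using that(3)
  proof
    assume "i + 2 \<le> j"
    then show ?thesis using A_orthogonal[OF m d] that by simp
  next
    assume "j + 2 \<le> i"
    then have "A j (A i v) = 0" using A_orthogonal[OF m d] that by simp
    then show ?thesis using A_commute[OF that] by simp
  qed
  interpret irreducible_braided_orthogonal s m
    by unfold_locales (use m AA in auto)
  show False using dim_E_le_2 d3 by simp
qed

end

section \<open>Rank over an arbitrary field\<close>

text \<open>Expanding the rows in a basis \<open>B\<close> of the row space factors \<open>M\<close>
  through a space of dimension \<open>card B\<close>; the coefficient vectors \<open>C b\<close>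
  then span all columns.\<close>

lemma dim_columns_le_dim_rows:
  fixes M :: "'k::field^'n^'m"
  shows "vec.dim (columns M) \<le> vec.dim (rows M)"
proof -
  obtain B where B: "B \<subseteq> rows M" "vec.independent B" "rows M \<subseteq> vec.span B" "card B = vec.dim (rows M)"
    using vec.basis_exists by blast
  have fB: "finite B" using B(2) by (rule vec.finiteI_independent)
  have "\<exists>c. row i M = (\<Sum>b\<in>B. c b *s b)" for i
  proof -
    have "row i M \<in> vec.span B" using B(3) by (auto simp: rows_def)
    then show ?thesis using vec.span_finite[OF fB] by auto
  qed
  then obtain c where c: "\<And>i. row i M = (\<Sum>b\<in>B. c i b *s b)" by metis
  define C where "C b = (\<chi> i. c i b)" for b
  have "column j M = (\<Sum>b\<in>B. (b $ j) *s C b)" for j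
  proof (rule vec_eq_iff[THEN iffD2], rule allI)
    fix i
    have "column j M $ i = row i M $ j" by (simp add: row_def column_def)
    also have "\<dots> = (\<Sum>b\<in>B. (b $ j) *s C b) $ i"
      unfolding c by (simp add: C_def mult.commute)
    finally show "column j M $ i = (\<Sum>b\<in>B. (b $ j) *s C b) $ i" .
  qed
  moreover have "(\<Sum>b\<in>B. (b $ j) *s C b) \<in> vec.span (C ` B)" for j
    by (intro vec.span_sum vec.span_scale vec.span_base imageI)
  ultimately have "columns M \<subseteq> vec.span (C ` B)"
    by (auto simp: columns_def)
  then have "vec.dim (columns M) \<le> card (C ` B)"
    using fB by (intro vec.dim_le_card) auto
  also have "\<dots> \<le> vec.dim (rows M)"
    using card_image_le[OF fB, of C] B(4) by simp
  finally show ?thesis .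
qed

text \<open>\<open>rank\<close> is the dimension of the row space, so row and column rank are
  matched first, the reverse inequality coming from the transpose; the column space is the
  range.\<close>

lemma rank_eq_dim_range:
  fixes M :: "'k::field^'n^'m"
  shows "rank M = vec.dim (range ((*v) M))"
proof -
  have "vec.dim (rows M) \<le> vec.dim (columns M)"
    using dim_columns_le_dim_rows[of "transpose M"] by (simp add: columns_transpose rows_transpose)
  then have "rank M = vec.dim (columns M)"
    using dim_columns_le_dim_rows[of M] by (simp add: row_rank_def_gen)
  also have "vec.span (columns M) = range ((*v) M)"
  proof
    have "column j M = M *v axis j 1" for j
      by (simp add: vec_eq_iff column_def matrix_vector_mult_def axis_def if_distrib cong: if_cong)
    then show "vec.span (columns M) \<subseteq> range ((*v) M)"
      by (intro vec.span_minimal vec.linear_subspace_image[OF matrix_vector_mul_linear_gen vec.subspace_UNIV])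
        (auto simp: columns_def)
    show "range ((*v) M) \<subseteq> vec.span (columns M)"
      using matrix_vector_mult_in_columnspace_gen by blast
  qed
  then have "vec.dim (columns M) = vec.dim (range ((*v) M))"
    by (metis vec.dim_span)
  finally show ?thesis .
qed

section \<open>Representations of the braid group\<close>

lemma bij_matrix_vector_mult:
  fixes M :: "'k::field^'r^'r"
  assumes "invertible M" shows "bij ((*v) M)"
proof -
  obtain N where "M ** N = mat 1" "N ** M = mat 1"
    using assms unfolding invertible_def by blast
  then show ?thesis
    by (intro o_bij[of "(*v) N"]) (auto simp: fun_eq_iff matrix_vector_mul_assoc)
qed

lemma matrix_rep_mult:
  assumes "matrix_rep G \<rho>" "x \<in> carrier G" "y \<in> carrier G"
  shows "\<rho> (x \<otimes>\<^bsub>G\<^esub> y) *v v = \<rho> x *v (\<rho> y *v v)"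
  using assms by (simp add: matrix_rep_def hom_def GL_def matrix_vector_mul_assoc)

lemma matrix_rep_one:
  assumes "matrix_rep G \<rho>" shows "\<rho> \<one>\<^bsub>G\<^esub> = mat 1"
proof -
  have "group_hom G GL \<rho>"
    using assms group_GL unfolding matrix_rep_def group_hom_def group_hom_axioms_def by blast
  from group_hom.hom_one[OF this] show ?thesis by (simp add: GL_def)
qed

lemma matrix_rep_invertible: "matrix_rep G \<rho> \<Longrightarrow> x \<in> carrier G \<Longrightarrow> invertible (\<rho> x)"
  by (auto simp: matrix_rep_def hom_def GL_def)

lemma braided_matrix_rep:
  assumes rep: "matrix_rep (braid_group n) \<rho>"
  shows "braided {1..n - 1} (\<lambda>i. (*v) (\<rho> (braid_gen n i)))"
proof -
  let ?g = "braid_gen n"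
  note cl = braid_gen_closed
  note mult = matrix_rep_mult[OF rep]
  have closed2: "?g i \<otimes>\<^bsub>braid_group n\<^esub> ?g j \<in> carrier (braid_group n)"
    if "i \<in> {1..n - 1}" "j \<in> {1..n - 1}" for i j
    using that group_braid_group[of n] by (intro monoid.m_closed group.is_monoid cl)
  have com: "\<rho> (?g i) *v (\<rho> (?g j) *v v) = \<rho> (?g j) *v (\<rho> (?g i) *v v)"
    if ij: "i \<in> {1..n - 1}" "j \<in> {1..n - 1}" "i + 2 \<le> j" for i j v
  proof -
    have "?g i \<otimes>\<^bsub>braid_group n\<^esub> ?g j = ?g j \<otimes>\<^bsub>braid_group n\<^esub> ?g i"
      using ij by (intro braid_gen_commute) auto
    then show ?thesis
      using mult[OF cl cl, OF ij(1,2)] mult[OF cl cl, OF ij(2,1)] by metis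
  qed
  have br: "\<rho> (?g i) *v (\<rho> (?g (Suc i)) *v (\<rho> (?g i) *v v)) =
      \<rho> (?g (Suc i)) *v (\<rho> (?g i) *v (\<rho> (?g (Suc i)) *v v))"
    if i: "i \<in> {1..n - 1}" "Suc i \<in> {1..n - 1}" for i v
  proof -
    have "i \<in> {1..n - 2}" using i by simp
    from braid_gen_braid[OF this]
    have "?g i \<otimes>\<^bsub>braid_group n\<^esub> ?g (Suc i) \<otimes>\<^bsub>braid_group n\<^esub> ?g i =
        ?g (Suc i) \<otimes>\<^bsub>braid_group n\<^esub> ?g i \<otimes>\<^bsub>braid_group n\<^esub> ?g (Suc i)"
      by (simp only: Suc_eq_plus1)
    then have "\<rho> (?g i \<otimes>\<^bsub>braid_group n\<^esub> ?g (Suc i) \<otimes>\<^bsub>braid_group n\<^esub> ?g i) *v v =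
        \<rho> (?g (Suc i) \<otimes>\<^bsub>braid_group n\<^esub> ?g i \<otimes>\<^bsub>braid_group n\<^esub> ?g (Suc i)) *v v"
      by (rule arg_cong)
    then show ?thesis
      unfolding mult[OF closed2[OF i] cl[OF i(1)]] mult[OF closed2[OF i(2,1)] cl[OF i(2)]]
        mult[OF cl[OF i(1)] cl[OF i(2)]] mult[OF cl[OF i(2)] cl[OF i(1)]] .
  qed
  show ?thesis
    unfolding braided_def using com br
    by (auto intro!: matrix_vector_mul_linear_gen bij_matrix_vector_mult
        matrix_rep_invertible[OF rep] cl)
qed

text \<open>Induction over words. A letter for an inverse is harmless because the generator, being
  injective and preserving \<open>W\<close>, reflects membership in \<open>W\<close>.\<close>

lemma invariant_of_stable_under:
  fixes \<rho> :: "(nat \<times> bool) list set \<Rightarrow> 'k::field^'r^'r"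
  assumes rep: "matrix_rep (braid_group n) \<rho>"
    and W: "stable_under {1..n - 1} (\<lambda>i. (*v) (\<rho> (braid_gen n i))) W"
    and g: "g \<in> carrier (braid_group n)" and w: "w \<in> W"
  shows "\<rho> g *v w \<in> W"
proof -
  let ?S = "{1..n - 1}" and ?R = "braid_rels n" and ?G = "braid_group n"
  note mult = matrix_rep_mult[OF rep]
  have mult_class: "word_class ?S ?R u \<otimes>\<^bsub>?G\<^esub> word_class ?S ?R v = word_class ?S ?R (u @ v)"
    and class_closed: "word_class ?S ?R u \<in> carrier ?G" if "u \<in> words ?S" "v \<in> words ?S" for u v
    using that by (simp_all add: braid_group_def mult_presented_group carrier_presented_group)
  have one: "\<rho> (word_class ?S ?R []) = mat 1"
    using matrix_rep_one[OF rep] by (simp add: braid_group_def one_presented_group)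
  have gen: "\<rho> (word_class ?S ?R [(i, b)]) *v v \<in> W" if i: "i \<in> ?S" and v: "v \<in> W" for i b v
  proof (cases b)
    case True
    then show ?thesis
      using stableD[OF W i v] by (simp add: braid_gen_def)
  next
    case False
    let ?p = "[(i, True)]" and ?q = "[(i, False)]"
    have pq: "?p \<in> words ?S" "?q \<in> words ?S" using i by (auto simp: words_def)
    have "pres_eq ?S ?R (?p @ ?q) []"
      using pres_eq.cancel[OF i, of ?R True] by simp
    then have "word_class ?S ?R (?p @ ?q) = word_class ?S ?R []"
      using pq by (subst word_class_eq_iff) (simp_all only: words_append)
    then have eq: "\<rho> (braid_gen n i) *v (\<rho> (word_class ?S ?R ?q) *v v) = v"
      using mult[OF class_closed[OF pq] class_closed[OF pq(2,1)], of v] mult_class[OF pq] one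
      by (simp add: braid_gen_def)
    have bij: "bij ((*v) (\<rho> (braid_gen n i)))"
      by (intro bij_matrix_vector_mult matrix_rep_invertible[OF rep] braid_gen_closed i)
    have "\<rho> (braid_gen n i) *v (\<rho> (word_class ?S ?R ?q) *v v) \<in> W"
      unfolding eq by (rule v)
    then have "\<rho> (word_class ?S ?R ?q) *v v \<in> W"
      by (rule inj_lin_reflects_stable_subspace[OF matrix_vector_mul_linear_gen bij_is_inj[OF bij]
            stable_subspace[OF W] stableD[OF W i], rotated])
    then show ?thesis using False by simp
  qed
  have "\<rho> (word_class ?S ?R u) *v w \<in> W" if "u \<in> words ?S" for u
    using that
  proof (induction u)
    case Nil
    then show ?case using w one by simp
  next
    case (Cons a u)
    obtain i b where a: "a = (i, b)" by force
    have i: "i \<in> ?S" and u: "u \<in> words ?S" and ib: "[(i, b)] \<in> words ?S"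
      using Cons.prems by (auto simp: words_def a)
    show ?case
      using gen[OF i Cons.IH[OF u], of b] mult[OF class_closed[OF ib u] class_closed[OF u ib], of w]
        mult_class[OF ib u] by (simp add: a)
  qed
  then show ?thesis
    using g by (auto simp: braid_group_def carrier_presented_group)
qed

theorem theorem6p2:
  fixes n :: nat and \<rho> :: "(nat \<times> bool) list set \<Rightarrow> complex^'r^'r"
  assumes "n \<ge> 10"
    and "irreducible_rep (braid_group n) \<rho>"
  shows "\<forall>i\<in>{1..n - 1}. rank (\<rho> (braid_gen n i) - mat 1) \<noteq> 3"
proof
  fix i assume i: "i \<in> {1..n - 1}"
  let ?s = "\<lambda>i. (*v) (\<rho> (braid_gen n i))"
  have rep: "matrix_rep (braid_group n) \<rho>"
    and irr: "\<And>W. vec.subspace W \<Longrightarrow> \<forall>g\<in>carrier (braid_group n). \<forall>w\<in>W. \<rho> g *v w \<in> W \<Longrightarrow>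
      W = {0} \<or> W = UNIV"
    using assms(2) unfolding irreducible_rep_def by blast+
  \<comment> \<open>There are n - 1 generators, so \<open>n \<ge> 10\<close> supplies the nine
    required by \<open>dim_range_A_ne_3\<close>.\<close>
  interpret irreducible_braided ?s "n - 1"
  proof
    show "braided {1..n - 1} ?s" by (rule braided_matrix_rep[OF rep])
    show "W = {0} \<or> W = UNIV" if "stable_under {1..n - 1} ?s W" for W
      using that irr stable_subspace invariant_of_stable_under[OF rep] by blast
  qed
  have "(*v) (\<rho> (braid_gen n i) - mat 1) = A i"
    by (simp add: fun_eq_iff A_def matrix_vector_mult_diff_rdistrib)
  then show "rank (\<rho> (braid_gen n i) - mat 1) \<noteq> 3"
    using dim_range_A_ne_3[OF _ i] assms(1) by (simp add: rank_eq_dim_range)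
qed

end
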